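(* Let $\mathbb F$ be any field, let $n,k$ be positive integers with $n \ge k+2$, and let $\mathcal K \subseteq M_{n\times k}(\mathbb F)$ be a linear variety. Then the following are equivalent: (1) $\det_{n,k}(X)=0$ for all $X\in\mathcal K$ and $\operatorname{codim}(\mathcal K)=k$; (2) $k$ is odd and $\mathcal K$ is the vector space of all $X\in M_{n\times k}(\mathbb F)$ whose alternating row sum vanishes, i.e. $\sum_{i=1}^n (-1)^i X[i|) = 0$, where $X[i|)$ denotes the $i$-th row of $X$.
   Context: A linear variety in a finite-dimensional space $W$ is a nonempty set of the form $\mathcal K=\mathbf s+V=\{\mathbf s+\mathbf v:\mathbf v\in V\}$ with $V\subseteq W$ a linear subspace (uniquely determined by $\mathcal K$); $\dim\mathcal K=\dim V$ and $\operatorname{codim}\mathcal K=\dim W-\dim V$. Here $W=M_{n\times k}(\mathbb F)$, of dimension $nk$. Cullis' determinant: for $n\ge k$ and $X\in M_{n\times k}(\mathbb F)$, $\det_{n,k}(X)=\sum_{c}\operatorname{sgn}(c)\det\big(X[c|)\big)$, where $c$ ranges over the $k$-element subsets of $[n]=\{1,\dots,n\}$, $X[c|)$ is the $k\times k$ submatrix of $X$ formed by the rows with indices in $c$ (in increasing order), and, writing $c=\{c(1)<\dots<c(k)\}$, $\operatorname{sgn}(c)=(-1)^{\sum_{\alpha=1}^k (c(\alpha)-\alpha)}$. For $n=k$ it is the ordinary determinant. *)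

theory Defs
  imports Complex_Main "HOL-Library.Function_Algebras" "HOL-Combinatorics.Permutations"
begin

text \<open>An n x k matrix over a field is modelled as a function nat => nat => 'a,
  with rows indexed by 1..n and columns by 1..k, and all entries outside
  this range equal to zero.  Addition and scaling are pointwise.\<close>

definition mat_space :: "nat \<Rightarrow> nat \<Rightarrow> (nat \<Rightarrow> nat \<Rightarrow> 'a::zero) set" where
  "mat_space n k = {X. \<forall>i j. (i \<notin> {1..n} \<or> j \<notin> {1..k}) \<longrightarrow> X i j = 0}"

definition mscale :: "'a::field \<Rightarrow> (nat \<Rightarrow> nat \<Rightarrow> 'a) \<Rightarrow> (nat \<Rightarrow> nat \<Rightarrow> 'a)" where
  "mscale c X = (\<lambda>i j. c * X i j)"

lemma vector_space_mscale: "vector_space (mscale :: 'a::field \<Rightarrow> _)"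
  unfolding vector_space_def mscale_def by (auto simp: algebra_simps fun_eq_iff)

definition det_k :: "nat \<Rightarrow> (nat \<Rightarrow> nat \<Rightarrow> 'a::comm_ring_1) \<Rightarrow> 'a" where
  "det_k k M = (\<Sum>p | p permutes {1..k}. of_int (sign p) * (\<Prod>i\<in>{1..k}. M i (p i)))"

definition elem_of :: "nat set \<Rightarrow> nat \<Rightarrow> nat" where
  "elem_of c \<alpha> = sorted_list_of_set c ! (\<alpha> - 1)"

definition rows_sub :: "(nat \<Rightarrow> nat \<Rightarrow> 'a) \<Rightarrow> nat set \<Rightarrow> (nat \<Rightarrow> nat \<Rightarrow> 'a)" where
  "rows_sub X c = (\<lambda>\<alpha> j. X (elem_of c \<alpha>) j)"

definition sgn_sub :: "nat \<Rightarrow> nat set \<Rightarrow> int" where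
  "sgn_sub k c = (-1) ^ (\<Sum>\<alpha>=1..k. elem_of c \<alpha> - \<alpha>)"

definition cullis_det :: "nat \<Rightarrow> nat \<Rightarrow> (nat \<Rightarrow> nat \<Rightarrow> 'a::comm_ring_1) \<Rightarrow> 'a" where
  "cullis_det n k X = (\<Sum>c | c \<subseteq> {1..n} \<and> card c = k. of_int (sgn_sub k c) * det_k k (rows_sub X c))"

definition linear_variety :: "nat \<Rightarrow> nat \<Rightarrow> (nat \<Rightarrow> nat \<Rightarrow> 'a::field) set \<Rightarrow> bool" where
  "linear_variety n k K \<longleftrightarrow> (\<exists>s V. s \<in> mat_space n k \<and> V \<subseteq> mat_space n k \<and>
      module.subspace mscale V \<and> K = (\<lambda>v. s + v) ` V)"

definition direction :: "(nat \<Rightarrow> nat \<Rightarrow> 'a::ab_group_add) set \<Rightarrow> (nat \<Rightarrow> nat \<Rightarrow> 'a) set" where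
  "direction K = {X - Y | X Y. X \<in> K \<and> Y \<in> K}"

definition variety_codim :: "nat \<Rightarrow> nat \<Rightarrow> (nat \<Rightarrow> nat \<Rightarrow> 'a::field) set \<Rightarrow> nat" where
  "variety_codim n k K = n * k - vector_space.dim mscale (direction K)"

end

theory Submission
  imports Defs "Jordan_Normal_Form.Determinant"
begin

text \<open>
  After multiplying row \<open>i\<close> by \<open>(-1)^i\<close>, Cullis' determinant becomes, up to sign, the unsigned sum
  of all maximal minors, i.e. the top degree part of \<open>\<Prod>\<^sub>i (1 + r\<^sub>i)\<close> in the exterior algebra, where
  \<open>r\<^sub>1, \<dots>, r\<^sub>n\<close> are the rows. With \<open>S = \<Sum>\<^sub>i r\<^sub>i\<close> this product is \<open>(1 + S) E\<close> for an even element \<open>E\<close>,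
  so for odd \<open>k\<close> the form vanishes whenever \<open>S = 0\<close>.

  For the converse, let \<open>\<K>\<close> be cut out by at most \<open>k\<close> affine equations and argue by induction on \<open>k\<close>.
  If no nontrivial functional of the last column were constant on \<open>\<K>\<close>, that column could be any
  unit vector \<open>e\<^sub>i\<close>; deleting it together with row \<open>i\<close>, which eliminates one equation, leads to the
  statement for \<open>k - 1\<close>, and comparing the results for different \<open>i\<close> shows that the equations leave
  less freedom than their number allows. The same holds for every column and for every sum of two columns,
  whence \<open>\<K>\<close> consists of all \<open>X\<close> with \<open>a\<^sup>T X = c\<close> for a fixed \<open>a \<noteq> 0\<close> and \<open>c\<close>. As
  \<open>(1 + y) (1 - y) = 1\<close>, opposite adjacent rows can be deleted, which forces \<open>a\<close> to be constant.
\<close>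

section \<open>Determinants\<close>

lemma image_Suc_less: "Suc ` {0..<k} = {1..k}"
  by (metis One_nat_def atLeastLessThanSuc_atLeastAtMost image_Suc_atLeastLessThan)

text \<open>Conjugation by \<open>Suc\<close> turns the Leibniz sum over permutations of
  \<open>{1..k}\<close> into the one over \<open>{0..<k}\<close>, so that multiplicativity and
  Laplace expansion of \<open>det\<close> become available.\<close>

lemma det_k_eq_det: "det_k k M = det (mat k k (\<lambda>(i, j). M (Suc i) (Suc j)))"
proof -
  let ?A = "mat k k (\<lambda>(i, j). M (Suc i) (Suc j))"
  let ?h = "map_permutation {0..<k} Suc"
  note im = image_Suc_less[of k]
  have bij: "bij_betw Suc {0..<k} {1..k}"
    using im by (simp add: bij_betw_def)
  have bij2: "bij_betw ?h {p. p permutes {0..<k}} {p. p permutes {1..k}}"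
  proof (rule bij_betwI[where g = "map_permutation {1..k} (\<lambda>i. i - 1)"])
    have bij': "bij_betw (\<lambda>i. i - 1) {1..k} {0..<k}"
      by (rule bij_betwI[where g = Suc]) auto
    show "?h \<in> {p. p permutes {0..<k}} \<rightarrow> {p. p permutes {1..k}}"
      using map_permutation_permutes[OF bij] by blast
    show "map_permutation {1..k} (\<lambda>i. i - 1) \<in> {p. p permutes {1..k}} \<rightarrow> {p. p permutes {0..<k}}"
      using map_permutation_permutes[OF bij'] by blast
    show "map_permutation {1..k} (\<lambda>i. i - 1) (?h p) = p" if "p \<in> {p. p permutes {0..<k}}" for p
      by (rule map_permutation_compose_inv[OF bij]) (use that in auto)
    show "?h (map_permutation {1..k} (\<lambda>i. i - 1) p) = p" if "p \<in> {p. p permutes {1..k}}" for p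
      by (rule map_permutation_compose_inv[OF bij']) (use that in auto)
  qed
  have "det ?A = (\<Sum>p | p permutes {0..<k}. of_int (sign p) * (\<Prod>i = 0..<k. ?A $$ (i, p i)))"
    by (rule det_def') simp
  also have "\<dots> = (\<Sum>p | p permutes {0..<k}. of_int (sign (?h p)) * (\<Prod>i\<in>{1..k}. M i (?h p i)))"
  proof (rule sum.cong[OF refl])
    fix p assume "p \<in> {p. p permutes {0..<k}}"
    then have p: "p permutes {0..<k}" by simp
    have "(\<Prod>i\<in>{1..k}. M i (?h p i)) = (\<Prod>i\<in>{0..<k}. M (Suc i) (?h p (Suc i)))"
      unfolding im[symmetric] by (subst prod.reindex) (auto simp: o_def)
    also have "\<dots> = (\<Prod>i = 0..<k. ?A $$ (i, p i))"
    proof (rule prod.cong[OF refl])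
      fix i assume i: "i \<in> {0..<k}"
      then have "p i < k" using permutes_in_image[OF p, of i] by simp
      moreover have "?h p (Suc i) = Suc (p i)"
        by (rule map_permutation_apply) (use i in auto)
      ultimately show "M (Suc i) (?h p (Suc i)) = ?A $$ (i, p i)" using i by simp
    qed
    finally show "of_int (sign p) * (\<Prod>i = 0..<k. ?A $$ (i, p i)) =
        of_int (sign (?h p)) * (\<Prod>i\<in>{1..k}. M i (?h p i))"
      using sign_map_permutation[of Suc "{0..<k}" p] p by simp
  qed
  also have "\<dots> = det_k k M"
    unfolding det_k_def by (rule sum.reindex_bij_betw[OF bij2])
  finally show ?thesis ..
qed

lemma det_k_cong:
  assumes "\<And>i j. i \<in> {1..k} \<Longrightarrow> j \<in> {1..k} \<Longrightarrow> M i j = N i j"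
  shows "det_k k M = det_k k N"
  unfolding det_k_def
proof (rule sum.cong[OF refl])
  fix p assume "p \<in> {p. p permutes {1..k}}"
  then have "p i \<in> {1..k}" if "i \<in> {1..k}" for i using that by (simp only: permutes_in_image mem_Collect_eq)
  then show "of_int (sign p) * (\<Prod>i\<in>{1..k}. M i (p i)) = of_int (sign p) * (\<Prod>i\<in>{1..k}. N i (p i))"
    using assms by (auto intro!: prod.cong arg_cong2[where f = "(*)"])
qed

lemma det_k_scale_rows: "det_k k (\<lambda>i j. u i * M i j) = (\<Prod>i\<in>{1..k}. u i) * det_k k M"
  unfolding det_k_def by (simp add: prod.distrib sum_distrib_left mult_ac)

lemma det_k_row_add:
  assumes "m \<in> {1..k}" and "\<And>i. i \<in> {1..k} - {m} \<Longrightarrow> A i = C i"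
    and "\<And>i. i \<in> {1..k} - {m} \<Longrightarrow> B i = C i" and "C m = A m + B m"
  shows "det_k k C = det_k k A + det_k k B"
proof -
  have rem: "(\<Prod>i\<in>{1..k}. M i (p i)) = M m (p m) * (\<Prod>i\<in>{1..k} - {m}. C i (p i))"
    if "\<And>i. i \<in> {1..k} - {m} \<Longrightarrow> M i = C i" for M p
    using assms(1) that by (subst prod.remove[of _ m]) (auto intro!: prod.cong)
  show ?thesis
    unfolding det_k_def sum.distrib[symmetric]
    by (intro sum.cong refl, subst (1 2 3) rem) (use assms in \<open>auto simp: ring_distribs\<close>)
qed

lemma det_k_row_scale:
  assumes "m \<in> {1..k}" and "\<And>i. i \<in> {1..k} - {m} \<Longrightarrow> A i = C i" and "\<And>j. C m j = c * A m j"
  shows "det_k k C = c * det_k k A"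
proof -
  have "det_k k C = det_k k (\<lambda>i j. (if i = m then c else 1) * A i j)"
    by (rule det_k_cong) (use assms in auto)
  then have "det_k k C = (\<Prod>i\<in>{1..k}. if i = m then c else 1) * det_k k A"
    by (simp only: det_k_scale_rows)
  then show ?thesis using assms(1) by simp
qed

lemma det_k_identical_rows:
  assumes "i \<in> {1..k}" "j \<in> {1..k}" "i \<noteq> j" "M i = M j"
  shows "det_k k M = 0"
  unfolding det_k_eq_det
  by (rule det_identical_rows[of _ k "i - 1" "j - 1"]) (use assms in \<open>auto simp: fun_eq_iff\<close>)

lemma det_k_mult: "det_k k (\<lambda>i j. \<Sum>l\<in>{1..k}. M i l * g l j) = det_k k M * det_k k g"
proof -
  let ?m = "\<lambda>M :: nat \<Rightarrow> nat \<Rightarrow> 'a. mat k k (\<lambda>(i, j). M (Suc i) (Suc j))"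
  have "?m (\<lambda>i j. \<Sum>l\<in>{1..k}. M i l * g l j) = ?m M * ?m g"
    unfolding image_Suc_less[symmetric]
    by (rule eq_matI) (auto simp: scalar_prod_def sum.reindex simp del: image_Suc_atLeastLessThan)
  then show ?thesis
    by (simp add: det_k_eq_det det_mult[of _ k])
qed

text \<open>Laplace expansion along a column in which only row \<open>m\<close> may be nonzero; the
  index \<open>if i < m then i else Suc i\<close> skips the deleted row.\<close>

lemma det_k_last_column:
  assumes m: "m \<in> {1..Suc k}"
    and col: "\<And>i. i \<in> {1..Suc k} \<Longrightarrow> i \<noteq> m \<Longrightarrow> M i (Suc k) = 0"
  shows "det_k (Suc k) M =
    (-1) ^ (Suc k - m) * M m (Suc k) * det_k k (\<lambda>i. M (if i < m then i else Suc i))"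
proof -
  let ?A = "mat (Suc k) (Suc k) (\<lambda>(i, j). M (Suc i) (Suc j))"
  have A: "?A \<in> carrier_mat (Suc k) (Suc k)" by simp
  have m': "m - 1 < Suc k" using m by auto
  have "det ?A = (\<Sum>i<Suc k. ?A $$ (i, k) * cofactor ?A i k)"
    by (rule laplace_expansion_column[OF A]) simp
  also have "\<dots> = ?A $$ (m - 1, k) * cofactor ?A (m - 1) k"
  proof (rule sum.remove[THEN trans])
    show "?A $$ (m - 1, k) * cofactor ?A (m - 1) k +
        (\<Sum>i\<in>{..<Suc k} - {m - 1}. ?A $$ (i, k) * cofactor ?A i k) = ?A $$ (m - 1, k) * cofactor ?A (m - 1) k"
    proof -
      have "M (Suc i) (Suc k) = 0" if "i \<in> {..<Suc k} - {m - 1}" for i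
        using col[of "Suc i"] m that by auto
      then show ?thesis by (auto intro!: sum.neutral)
    qed
  qed (use m' in auto)
  also have "mat_delete ?A (m - 1) k = mat k k (\<lambda>(i, j). M (if Suc i < m then Suc i else Suc (Suc i)) (Suc j))"
    using m by (intro eq_matI) (auto simp: mat_delete_def)
  then have "cofactor ?A (m - 1) k = (-1) ^ (m - 1 + k) * det_k k (\<lambda>i. M (if i < m then i else Suc i))"
    by (simp add: cofactor_def det_k_eq_det if_distrib cong: if_cong)
  \<comment> \<open>The two exponents add up to \<open>2 * k\<close>, so their parities
    agree.\<close>
  also have "(-1) ^ (m - 1 + k) = (-1 :: 'a) ^ (Suc k - m)"
    using m by (simp add: minus_one_power_iff)
  finally show ?thesis using m m' by (simp add: det_k_eq_det mult_ac)
qed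

lemma det_k_last_column_0:
  assumes "\<And>i. i \<in> {1..Suc k} \<Longrightarrow> M i (Suc k) = 0"
  shows "det_k (Suc k) M = 0"
  using det_k_last_column[of 1 k M] assms by simp

text \<open>Only the identity permutation contributes: a permutation fixing every index but
  \<open>m\<close> also fixes \<open>m\<close>, so any other one meets an off-diagonal zero in a row
  different from \<open>m\<close>.\<close>

lemma det_k_identity_replace_row:
  assumes m: "m \<in> {1..k}"
  shows "det_k k (\<lambda>i j. if i = m then b j else if i = j then 1 else 0) = b m"
proof -
  let ?M = "\<lambda>i j. if i = m then b j else if i = j then 1 else (0 :: 'a)"
  have "det_k k ?M = (\<Sum>p | p permutes {1..k}. if p = id then b m else 0)"
    unfolding det_k_def
  proof (rule sum.cong[OF refl])
    fix p assume "p \<in> {p. p permutes {1..k}}"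
    then have p: "p permutes {1..k}" by simp
    show "of_int (sign p) * (\<Prod>i\<in>{1..k}. ?M i (p i)) = (if p = id then b m else 0)"
    proof (cases "p = id")
      case True
      then have "(\<Prod>i\<in>{1..k}. ?M i (p i)) = (\<Prod>i\<in>{1..k}. if i = m then b m else 1)"
        by (intro prod.cong) auto
      then show ?thesis using True m by simp
    next
      case False
      have "\<exists>i\<in>{1..k}. i \<noteq> m \<and> p i \<noteq> i"
      proof (rule ccontr)
        assume "\<not> ?thesis"
        then have fx: "p i = i" if "i \<noteq> m" for i
          using that p by (metis permutes_not_in)
        have "p m = m" using fx p by (metis permutes_inj injD)
        then show False using False fx by (metis eq_id_iff)
      qed
      then obtain i where "i \<in> {1..k}" "?M i (p i) = 0" by force
      then have "(\<Prod>i\<in>{1..k}. ?M i (p i)) = 0" by (intro prod_zero) blast+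
      then show ?thesis using False by simp
    qed
  qed
  also have "\<dots> = b m"
    by (subst sum.delta) (auto simp: finite_permutations permutes_id)
  finally show ?thesis .
qed

section \<open>Sums of maximal minors\<close>

definition det_rows :: "nat \<Rightarrow> (nat \<Rightarrow> 'a::comm_ring_1) list \<Rightarrow> 'a" where
  "det_rows k ws = det_k k (\<lambda>i. ws ! (i - 1))"

lemma det_rows_add:
  assumes "Suc (length u + length v) = k"
  shows "det_rows k (u @ (x + y) # v) = det_rows k (u @ x # v) + det_rows k (u @ y # v)"
  unfolding det_rows_def
proof (rule det_k_row_add)
  show "Suc (length u) \<in> {1..k}" using assms by auto
qed (use assms in \<open>auto simp: nth_append nth_Cons' fun_eq_iff\<close>)

lemma det_rows_scale:
  assumes "Suc (length u + length v) = k"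
  shows "det_rows k (u @ (\<lambda>j. c * x j) # v) = c * det_rows k (u @ x # v)"
  unfolding det_rows_def
proof (rule det_k_row_scale)
  show "Suc (length u) \<in> {1..k}" using assms by auto
qed (use assms in \<open>auto simp: nth_append nth_Cons' fun_eq_iff\<close>)

lemma det_rows_alt:
  assumes "length u + length v + 2 = k"
  shows "det_rows k (u @ x # x # v) = 0"
  unfolding det_rows_def
proof (rule det_k_identical_rows)
  show "Suc (length u) \<in> {1..k}" "Suc (Suc (length u)) \<in> {1..k}" using assms by auto
qed (use assms in \<open>auto simp: nth_append nth_Cons' fun_eq_iff\<close>)

lemma det_rows_last_column:
  assumes len: "length u + length v = k"
    and z: "\<And>r. r \<in> set u \<union> set v \<Longrightarrow> r (Suc k) = 0"
  shows "det_rows (Suc k) (u @ r # v) = (-1) ^ length v * r (Suc k) * det_rows k (u @ v)"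
proof -
  have "det_rows (Suc k) (u @ r # v) =
    (-1) ^ (Suc k - Suc (length u)) * ((u @ r # v) ! (Suc (length u) - 1)) (Suc k)
      * det_k k (\<lambda>i. (u @ r # v) ! ((if i < Suc (length u) then i else Suc i) - 1))"
    unfolding det_rows_def
  proof (rule det_k_last_column)
    fix i assume i: "i \<in> {1..Suc k}" "i \<noteq> Suc (length u)"
    then have "(u @ r # v) ! (i - 1) \<in> set u \<union> set v"
      using len by (auto simp: nth_append nth_Cons')
    then show "((u @ r # v) ! (i - 1)) (Suc k) = 0" by (rule z)
  qed (use len in auto)
  also have "det_k k (\<lambda>i. (u @ r # v) ! ((if i < Suc (length u) then i else Suc i) - 1)) = det_rows k (u @ v)"
    unfolding det_rows_def
  proof (rule det_k_cong)
    fix i j assume i: "i \<in> {1..k}"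
    show "((u @ r # v) ! ((if i < Suc (length u) then i else Suc i) - 1)) j = ((u @ v) ! (i - 1)) j"
    proof (cases "i < Suc (length u)")
      case True
      then have "i - 1 < length u" using i by auto
      then show ?thesis using True by (simp add: nth_append)
    next
      case False
      then have "i - length u = Suc (i - 1 - length u)" "\<not> i - 1 < length u" by auto
      then show ?thesis using False by (simp add: nth_append)
    qed
  qed
  finally show ?thesis using len by auto
qed

lemma det_rows_last_column_0:
  assumes "length w = Suc k" and "\<And>r. r \<in> set w \<Longrightarrow> r (Suc k) = 0"
  shows "det_rows (Suc k) w = 0"
  unfolding det_rows_def
  by (rule det_k_last_column_0) (use assms in auto)

lemma det_rows_mult:
  assumes "length w = k"
  shows "det_rows k (map (\<lambda>r j. \<Sum>l\<in>{1..k}. r l * g l j) w) = det_rows k w * det_k k g"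
proof -
  have "det_rows k (map (\<lambda>r j. \<Sum>l\<in>{1..k}. r l * g l j) w) =
    det_k k (\<lambda>i j. \<Sum>l\<in>{1..k}. (w ! (i - 1)) l * g l j)"
    unfolding det_rows_def by (rule det_k_cong) (use assms in auto)
  then show ?thesis by (simp only: det_k_mult det_rows_def)
qed

text \<open>The prefix \<open>w\<close> holds the rows chosen so far, and each further row is either
  skipped or appended. This evaluates the degree \<open>k\<close> part of the wedge of
  \<open>w\<close> with the product of all \<open>1 + r\<close>, in a form suited to induction on
  the list of rows.\<close>

fun minor_sum :: "nat \<Rightarrow> (nat \<Rightarrow> 'a::comm_ring_1) list \<Rightarrow> (nat \<Rightarrow> 'a) list \<Rightarrow> 'a" where
  "minor_sum k w [] = (if length w = k then det_rows k w else 0)"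
| "minor_sum k w (r # rs) = minor_sum k w rs + minor_sum k (w @ [r]) rs"

text \<open>The prefix behaves like a wedge product: this lemma and the next ones give
  multilinearity and alternation in its rows, inherited from the determinants at the end of the
  recursion.\<close>

lemma minor_sum_add:
  "minor_sum k (u @ (x + y) # v) rs = minor_sum k (u @ x # v) rs + minor_sum k (u @ y # v) rs"
  by (induction rs arbitrary: v) (simp_all add: det_rows_add)

lemma minor_sum_scale:
  "minor_sum k (u @ (\<lambda>j. c * x j) # v) rs = c * minor_sum k (u @ x # v) rs"
  by (induction rs arbitrary: v) (simp_all add: det_rows_scale ring_distribs)

lemma minor_sum_alt: "minor_sum k (u @ x # x # v) rs = 0"
  by (induction rs arbitrary: v) (simp_all add: det_rows_alt)

lemma minor_sum_zero: "minor_sum k (u @ 0 # v) rs = 0"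
  using minor_sum_scale[of k u 0 0 v rs] by (simp add: zero_fun_def)

lemma minor_sum_uminus: "minor_sum k (u @ (- x) # v) rs = - minor_sum k (u @ x # v) rs"
  using minor_sum_scale[of k u "- 1" x v rs] by (simp add: fun_Compl_def)

lemma minor_sum_swap: "minor_sum k (u @ x # y # v) rs = - minor_sum k (u @ y # x # v) rs"
proof -
  have "0 = minor_sum k (u @ (x + y) # (x + y) # v) rs"
    by (simp add: minor_sum_alt)
  also have "\<dots> = minor_sum k (u @ x # (x + y) # v) rs + minor_sum k (u @ y # (x + y) # v) rs"
    by (rule minor_sum_add)
  also have "minor_sum k (u @ x # (x + y) # v) rs =
      minor_sum k (u @ x # x # v) rs + minor_sum k (u @ x # y # v) rs"
    using minor_sum_add[of k "u @ [x]"] by simp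
  also have "minor_sum k (u @ y # (x + y) # v) rs =
      minor_sum k (u @ y # x # v) rs + minor_sum k (u @ y # y # v) rs"
    using minor_sum_add[of k "u @ [y]"] by simp
  finally show ?thesis by (simp add: minor_sum_alt eq_neg_iff_add_eq_0)
qed

lemma minor_sum_too_short: "length w + length rs < k \<Longrightarrow> minor_sum k w rs = 0"
  by (induction rs arbitrary: w) auto

lemma minor_sum_too_long: "length w > k \<Longrightarrow> minor_sum k w rs = 0"
  by (induction rs arbitrary: w) auto

lemma minor_sum_full: "length w + length rs = k \<Longrightarrow> minor_sum k w rs = det_rows k (w @ rs)"
  by (induction rs arbitrary: w) (auto simp: minor_sum_too_short)

lemma minor_sum_zeros: "minor_sum k w (rs @ replicate m 0) = minor_sum k w rs"
proof (induction rs arbitrary: w)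
  case Nil
  show ?case
  proof (induction m)
    case (Suc m)
    then show ?case using minor_sum_zero[of k w "[]"] by (simp del: zero_fun_apply)
  qed simp
qed simp

text \<open>In the exterior algebra \<open>(1 + y) (1 - y) = 1\<close>: the terms choosing exactly
  one of \<open>y\<close> and \<open>z\<close> cancel each other, and those choosing both repeat
  \<open>y\<close> up to sign.\<close>

lemma minor_sum_cancel:
  assumes "z = - y"
  shows "minor_sum k w (ps @ y # z # qs) = minor_sum k w (ps @ qs)"
proof (induction ps arbitrary: w)
  case Nil
  have "minor_sum k (w @ [y, z]) qs = - minor_sum k (w @ [y, y]) qs"
    unfolding assms using minor_sum_uminus[of k "w @ [y]" y "[]" qs] by simp
  moreover have "minor_sum k (w @ [z]) qs = - minor_sum k (w @ [y]) qs"
    unfolding assms by (rule minor_sum_uminus)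
  ultimately show ?case
    using minor_sum_alt[of k w y "[]" qs] by simp
qed simp

text \<open>In the exterior algebra, \<open>\<Prod>\<^sub>i (1 + r\<^sub>i) = (1 + S) E\<close> with \<open>S = \<Sum>\<^sub>i r\<^sub>i\<close> and \<open>E\<close> even, because
  \<open>(1 + S) (1 + r) = (1 + S + r) (1 + S r)\<close>; hence wedging with \<open>S\<close> maps the even part of
  the product to its odd part and kills the odd part.\<close>

lemma minor_sum_snoc_sum_list:
  assumes "length w \<le> k"
  shows "minor_sum k (w @ [sum_list rs]) rs = (if odd (k - length w) then minor_sum k w rs else 0)"
  using assms
proof (induction rs arbitrary: w)
  case Nil
  have "minor_sum k (w @ [sum_list []]) [] = 0" unfolding sum_list.Nil by (rule minor_sum_zero)
  moreover have "odd (k - length w) \<Longrightarrow> length w \<noteq> k" by auto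
  ultimately show ?case using Nil by (simp del: sum_list.Nil)
next
  case (Cons r rs)
  let ?S = "sum_list rs"
  show ?case
  proof (cases "length w = k")
    case True
    then show ?thesis by (simp add: minor_sum_too_long)
  next
    case False
    with Cons.prems have lt: "length w < k" by simp
    have "minor_sum k (w @ [sum_list (r # rs)]) (r # rs)
      = minor_sum k (w @ [r + ?S]) rs + minor_sum k (w @ [r + ?S, r]) rs"
      by simp
    also have "minor_sum k (w @ [r + ?S]) rs = minor_sum k (w @ [r]) rs + minor_sum k (w @ [?S]) rs"
      by (rule minor_sum_add)
    also have "minor_sum k (w @ [r + ?S, r]) rs
      = minor_sum k (w @ [r, r]) rs + minor_sum k (w @ [?S, r]) rs"
      by (rule minor_sum_add)
    also have "minor_sum k (w @ [r, r]) rs = 0" by (rule minor_sum_alt)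
    also have "minor_sum k (w @ [?S, r]) rs = - minor_sum k (w @ [r, ?S]) rs"
      by (rule minor_sum_swap)
    finally have *: "minor_sum k (w @ [sum_list (r # rs)]) (r # rs) =
      minor_sum k (w @ [r]) rs + minor_sum k (w @ [?S]) rs - minor_sum k (w @ [r, ?S]) rs"
      by (simp del: plus_fun_apply)
    have 1: "minor_sum k (w @ [?S]) rs = (if odd (k - length w) then minor_sum k w rs else 0)"
      using Cons.IH[of w] lt by simp
    have 2: "minor_sum k (w @ [r, ?S]) rs =
        (if odd (k - Suc (length w)) then minor_sum k (w @ [r]) rs else 0)"
      using Cons.IH[of "w @ [r]"] lt by simp
    \<comment> \<open>Appending \<open>r\<close> flips the parity, so exactly one of
      \<open>1\<close> and \<open>2\<close> is active. For odd \<open>k - length w\<close> the rest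
      is the recursion for \<open>r # rs\<close>; for even it cancels.\<close>
    have "odd (k - Suc (length w)) \<longleftrightarrow> even (k - length w)"
      using lt by (metis Suc_diff_Suc even_Suc)
    then show ?thesis using * unfolding 1 2 by (auto simp del: plus_fun_apply)
  qed
qed

text \<open>With the empty prefix and odd \<open>k\<close>, the sum equals the one with prefix
  \<open>[sum_list rs]\<close>, and a zero row in the prefix kills it.\<close>

lemma minor_sum_odd:
  assumes "odd k" and "sum_list rs = 0"
  shows "minor_sum k [] rs = 0"
  using minor_sum_snoc_sum_list[of "[]" k rs] minor_sum_zero[of k "[]" "[]" rs] assms by simp

text \<open>Choosing the new first row contributes the sum with prefix
  \<open>[- sum_list rs]\<close>, which vanishes for even \<open>k\<close>.\<close>

lemma minor_sum_even:
  assumes "even k"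
  shows "minor_sum k [] ((- sum_list rs) # rs) = minor_sum k [] rs"
  using minor_sum_snoc_sum_list[of "[]" k rs] minor_sum_uminus[of k "[]" "sum_list rs" "[]" rs] assms
  by simp

text \<open>Every single minor is multiplied by \<open>det_k k g\<close>, so column operations keep
  a vanishing sum at zero.\<close>

lemma minor_sum_map_mult:
  "minor_sum k (map (\<lambda>r j. \<Sum>l\<in>{1..k}. r l * g l j) w) (map (\<lambda>r j. \<Sum>l\<in>{1..k}. r l * g l j) rs)
    = minor_sum k w rs * det_k k g"
proof (induction rs arbitrary: w)
  case (Cons r rs)
  show ?case using Cons[of w] Cons[of "w @ [r]"] by (simp add: ring_distribs)
qed (simp add: det_rows_mult[unfolded One_nat_def])

lemma minor_sum_cong:
  assumes "list_all2 (\<lambda>r s. \<forall>j\<in>{1..k}. r j = s j) w v" "list_all2 (\<lambda>r s. \<forall>j\<in>{1..k}. r j = s j) rs qs"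
  shows "minor_sum k w rs = minor_sum k v qs"
  using assms(2,1)
proof (induction arbitrary: w v rule: list_all2_induct)
  case Nil
  then have "length w = length v" by (rule list_all2_lengthD)
  moreover have "det_rows k w = det_rows k v" if "length w = k"
    unfolding det_rows_def
    by (rule det_k_cong) (use Nil that in \<open>auto simp: list_all2_conv_all_nth\<close>)
  ultimately show ?case by simp
next
  case (Cons r rs s qs)
  have "minor_sum k (w @ [r]) rs = minor_sum k (v @ [s]) qs"
    by (rule Cons.IH) (use Cons in \<open>auto intro!: list_all2_appendI\<close>)
  then show ?case using Cons by simp
qed

lemma minor_sum_last_column_0:
  assumes "\<And>r. r \<in> set w \<union> set rs \<Longrightarrow> r (Suc k) = 0"
  shows "minor_sum (Suc k) w rs = 0"
  using assms
proof (induction rs arbitrary: w)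
  case Nil
  then show ?case by (simp add: det_rows_last_column_0)
next
  case (Cons r rs)
  have "minor_sum (Suc k) w rs = 0" "minor_sum (Suc k) (w @ [r]) rs = 0"
    by (rule Cons.IH; use Cons.prems in auto)+
  then show ?case by simp
qed

text \<open>Rows chosen later all land behind \<open>r\<close>. When \<open>Suc k\<close> rows are
  complete, exactly \<open>k - length u\<close> of them follow \<open>r\<close>, so the sign of the
  expansion is the same in all surviving terms.\<close>

lemma minor_sum_last_column_aux:
  assumes "\<And>r. r \<in> set u \<union> set v \<union> set rs \<Longrightarrow> r (Suc k) = 0" and "length u \<le> k"
  shows "minor_sum (Suc k) (u @ r # v) rs
    = (-1) ^ (k - length u) * r (Suc k) * minor_sum k (u @ v) rs"
  using assms
proof (induction rs arbitrary: v)
  case Nil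
  then show ?case using det_rows_last_column[of u v k r] by auto
next
  case (Cons q rs)
  have "minor_sum (Suc k) (u @ r # v) rs = (-1) ^ (k - length u) * r (Suc k) * minor_sum k (u @ v) rs"
    by (rule Cons.IH) (use Cons.prems in auto)
  moreover have "minor_sum (Suc k) (u @ r # (v @ [q])) rs =
      (-1) ^ (k - length u) * r (Suc k) * minor_sum k (u @ (v @ [q])) rs"
    by (rule Cons.IH) (use Cons.prems in auto)
  ultimately show ?case by (simp add: ring_distribs)
qed

text \<open>Each row of \<open>ps\<close> that is chosen stands before \<open>r\<close> and costs
  one sign in the expansion; replacing every row of \<open>ps\<close> by its negative accounts for
  this. A pointwise specified \<open>neg\<close> admits any syntactic form of negation.\<close>

lemma minor_sum_last_column:
  assumes neg: "\<And>r. neg r = - r"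
    and "\<And>r. r \<in> set w \<union> set ps \<union> set qs \<Longrightarrow> r (Suc k) = 0" and "length w \<le> k"
  shows "minor_sum (Suc k) w (ps @ r # qs)
    = (-1) ^ (k - length w) * r (Suc k) * minor_sum k w (map neg ps @ qs)"
  using assms(2-)
proof (induction ps arbitrary: w)
  case Nil
  then show ?case
    using minor_sum_last_column_0[of w qs k] minor_sum_last_column_aux[of w "[]" qs k r] by simp
next
  case (Cons p ps)
  have 1: "minor_sum (Suc k) w (ps @ r # qs)
      = (-1) ^ (k - length w) * r (Suc k) * minor_sum k w (map neg ps @ qs)"
    by (rule Cons.IH) (use Cons.prems in auto)
  have 2: "minor_sum (Suc k) (w @ [p]) (ps @ r # qs)
      = - ((-1) ^ (k - length w) * r (Suc k) * minor_sum k (w @ [p]) (map neg ps @ qs))"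
  proof (cases "length w = k")
    \<comment> \<open>A prefix that already has \<open>Suc k\<close> rows leaves no room for
      \<open>r\<close>: its determinant has a zero last column, and on the right the prefix is too
      long.\<close>
    case True
    have z: "minor_sum k (w @ [p]) rs = 0" for rs
      by (rule minor_sum_too_long) (simp add: True)
    have "minor_sum (Suc k) (w @ [p]) rs = 0" for rs
    proof (induction rs)
      case Nil
      then show ?case
        using True Cons.prems(1) by (auto intro!: det_rows_last_column_0)
    next
      case (Cons q rs)
      then show ?case using True minor_sum_too_long[of "Suc k" "(w @ [p]) @ [q]" rs] by simp
    qed
    then show ?thesis by (simp add: z)
  next
    case False
    then have "length w < k" using Cons.prems by simp
    then have "k - length w = Suc (k - length (w @ [p]))" by simp
    moreover have "minor_sum (Suc k) (w @ [p]) (ps @ r # qs)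
      = (-1) ^ (k - length (w @ [p])) * r (Suc k) * minor_sum k (w @ [p]) (map neg ps @ qs)"
      by (rule Cons.IH) (use Cons.prems False in auto)
    ultimately show ?thesis by simp
  qed
  show ?case
    using 1 2 minor_sum_uminus[of k w p "[]" "map neg ps @ qs", folded neg] by (simp add: ring_distribs)
qed

section \<open>From the recursion to Cullis' determinant\<close>

lemma minor_sum_upt:
  "minor_sum k w (map X [m..<Suc n]) =
    (\<Sum>c | c \<subseteq> {m..n} \<and> length w + card c = k. det_rows k (w @ map X (sorted_list_of_set c)))"
proof (induction "Suc n - m" arbitrary: m w)
  case 0
  then have "{c. c \<subseteq> {m..n} \<and> length w + card c = k} = (if length w = k then {{}} else {})"
    by auto
  then show ?case using 0 by simp
next
  case (Suc d)
  let ?S = "\<lambda>l m. {c. c \<subseteq> {m..n} \<and> l + card c = k}"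
  let ?D = "\<lambda>w c. det_rows k (w @ map X (sorted_list_of_set c))"
  have mn: "m \<le> n" using Suc.hyps(2) by auto
  have fin: "finite c" if "c \<subseteq> {m..n}" for c m using that finite_subset by blast
  have IH: "minor_sum k w (map X [Suc m..<Suc n]) = sum (?D w) (?S (length w) (Suc m))" for w
    using Suc by (intro Suc.hyps(1)) auto
  \<comment> \<open>Subsets avoiding \<open>m\<close> correspond to skipping row \<open>m\<close>,
    subsets containing it to appending that row to the prefix.\<close>
  have "?S (length w) m = ?S (length w) (Suc m) \<union> insert m ` ?S (Suc (length w)) (Suc m)"
  proof (intro equalityI subsetI)
    fix c assume c: "c \<in> ?S (length w) m"
    show "c \<in> ?S (length w) (Suc m) \<union> insert m ` ?S (Suc (length w)) (Suc m)"
    proof (cases "m \<in> c")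
      case True
      have "c = insert m (c - {m})" using True by auto
      moreover have "c - {m} \<in> ?S (Suc (length w)) (Suc m)"
        using c True fin[of c m] card_Suc_Diff1[of c m] by (auto simp: Suc_le_eq order.strict_iff_order)
      ultimately show ?thesis by blast
    next
      case False
      then show ?thesis using c by (auto simp: Suc_le_eq order.strict_iff_order)
    qed
  next
    fix c assume "c \<in> ?S (length w) (Suc m) \<union> insert m ` ?S (Suc (length w)) (Suc m)"
    then show "c \<in> ?S (length w) m"
    proof
      assume "c \<in> insert m ` ?S (Suc (length w)) (Suc m)"
      then obtain c' where c': "c = insert m c'" "c' \<subseteq> {Suc m..n}" "Suc (length w) + card c' = k" by auto
      then have "m \<notin> c'" "finite c'" using fin by auto
      then show ?thesis using c' mn by force
    qed force
  qed
  moreover have "finite (?S l m)" for l m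
    by (rule finite_subset[of _ "Pow {m..n}"]) auto
  moreover have "?S (length w) (Suc m) \<inter> insert m ` ?S (Suc (length w)) (Suc m) = {}" by auto
  ultimately have "sum (?D w) (?S (length w) m) = sum (?D w) (?S (length w) (Suc m))
      + sum (?D w) (insert m ` ?S (Suc (length w)) (Suc m))"
    by (simp add: sum.union_disjoint)
  also have "sum (?D w) (insert m ` ?S (Suc (length w)) (Suc m))
      = sum (?D (w @ [X m])) (?S (length (w @ [X m])) (Suc m))"
  proof (subst sum.reindex)
    show "inj_on (insert m) (?S (Suc (length w)) (Suc m))"
    proof (rule inj_onI)
      fix c c' assume "c \<in> ?S (Suc (length w)) (Suc m)" "c' \<in> ?S (Suc (length w)) (Suc m)"
        and "insert m c = insert m c'"
      then show "c = c'" by (metis (no_types, lifting) atLeastAtMost_iff insert_ident mem_Collect_eq not_less_eq_eq order_refl subsetD)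
    qed
    show "sum (?D w \<circ> insert m) (?S (Suc (length w)) (Suc m))
        = sum (?D (w @ [X m])) (?S (length (w @ [X m])) (Suc m))"
    proof (rule sum.cong)
      fix c assume "c \<in> ?S (length (w @ [X m])) (Suc m)"
      then have c: "c \<subseteq> {Suc m..n}" by auto
      have "sorted_list_of_set (insert m c) = m # sorted_list_of_set c"
        using c fin[OF c] sorted_list_of_set.idem_if_sorted_distinct[of "m # sorted_list_of_set c"]
        by fastforce
      then show "(?D w \<circ> insert m) c = ?D (w @ [X m]) c" by simp
    qed simp
  qed
  finally show ?case using mn by (simp only: IH upt_conv_Cons[of m "Suc n"] le_imp_less_Suc
        list.map minor_sum.simps)
qed

text \<open>The signs attached to subsets in \<open>cullis_det\<close> are absent here;
  \<open>cullis_det_eq\<close> trades them for signs of the rows.\<close>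

definition maximal_minor_sum :: "nat \<Rightarrow> nat \<Rightarrow> (nat \<Rightarrow> nat \<Rightarrow> 'a::comm_ring_1) \<Rightarrow> 'a" where
  "maximal_minor_sum n k X = minor_sum k [] (map X [1..<Suc n])"

text \<open>The subtraction in \<open>sgn_sub\<close> is truncated, so this bound is what makes it a
  true difference. Prepending 0 gives a strictly increasing list of naturals, whose entry at index
  \<open>\<alpha>\<close> is at least \<open>\<alpha>\<close>.\<close>

lemma elem_of_ge:
  assumes c: "c \<subseteq> {1..n}" "card c = k" and \<alpha>: "\<alpha> \<in> {1..k}"
  shows "\<alpha> \<le> elem_of c \<alpha>"
proof -
  have fin: "finite c" using c finite_subset by blast
  have "sorted_wrt (<) (0 # sorted_list_of_set c)"
    using c fin by (auto simp: strict_sorted_iff)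
  then have "\<alpha> \<le> (0 # sorted_list_of_set c) ! \<alpha>"
    using \<alpha> c(2) by (intro sorted_wrt_less_idx) auto
  then show ?thesis using \<alpha> by (simp add: elem_of_def nth_Cons')
qed

text \<open>The sign of \<open>c\<close> splits into \<open>(-1)\<close> to the sum of the elements
  of \<open>c\<close>, which distributes over the chosen rows, and
  \<open>(-1) ^ (\<Sum>{1..k})\<close>, which is the same for all \<open>c\<close>.\<close>

lemma cullis_det_eq:
  "cullis_det n k X = (-1) ^ (\<Sum>{1..k}) * maximal_minor_sum n k (\<lambda>i j. (-1) ^ i * X i j)"
proof -
  have "of_int (sgn_sub k c) * det_k k (rows_sub X c) = (-1) ^ (\<Sum>{1..k})
      * det_rows k ([] @ map (\<lambda>i j. (-1) ^ i * X i j) (sorted_list_of_set c))"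
    if c: "c \<subseteq> {1..n}" "card c = k" for c
  proof -
    have fin: "finite c" using c finite_subset by blast
    have "det_rows k (map (\<lambda>i j. (-1) ^ i * X i j) (sorted_list_of_set c)) =
        det_k k (\<lambda>\<alpha> j. (-1) ^ elem_of c \<alpha> * rows_sub X c \<alpha> j)"
      unfolding det_rows_def
      by (rule det_k_cong) (use c fin in \<open>auto simp: elem_of_def rows_sub_def\<close>)
    also have "\<dots> = (-1) ^ (\<Sum>\<alpha>\<in>{1..k}. elem_of c \<alpha>) * det_k k (rows_sub X c)"
      by (simp only: det_k_scale_rows power_sum)
    finally have 1: "det_rows k (map (\<lambda>i j. (-1) ^ i * X i j) (sorted_list_of_set c)) =
      (-1) ^ (\<Sum>\<alpha>\<in>{1..k}. elem_of c \<alpha>) * det_k k (rows_sub X c)" .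
    have "(\<Sum>\<alpha>\<in>{1..k}. elem_of c \<alpha>) = (\<Sum>\<alpha>\<in>{1..k}. elem_of c \<alpha> - \<alpha>) + \<Sum>{1..k}"
      unfolding sum.distrib[symmetric] using elem_of_ge[OF c] by (intro sum.cong) auto
    then have "(-1) ^ (\<Sum>{1..k}) * (-1) ^ (\<Sum>\<alpha>\<in>{1..k}. elem_of c \<alpha>) =
        ((-1) ^ (\<Sum>\<alpha>\<in>{1..k}. elem_of c \<alpha> - \<alpha>) :: 'a)"
      by (simp add: power_add mult.assoc[symmetric] power_mult_distrib[symmetric] mult.commute)
    then show ?thesis
      unfolding append_Nil 1 by (simp add: sgn_sub_def mult.assoc[symmetric])
  qed
  then show ?thesis
    unfolding cullis_det_def maximal_minor_sum_def minor_sum_upt sum_distrib_left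
    by (intro sum.cong) auto
qed

lemma cullis_det_eq_0_iff:
  "cullis_det n k X = 0 \<longleftrightarrow> maximal_minor_sum n k (\<lambda>i j. (-1) ^ i * X i j) = 0"
proof -
  have "(-1) ^ (\<Sum>{1..k}) * cullis_det n k X = maximal_minor_sum n k (\<lambda>i j. (-1) ^ i * X i j)"
    by (simp add: cullis_det_eq mult.assoc[symmetric] power_mult_distrib[symmetric])
  then have "maximal_minor_sum n k (\<lambda>i j. (-1) ^ i * X i j) = 0" if "cullis_det n k X = 0"
    using that by simp
  moreover have "cullis_det n k X = 0" if "maximal_minor_sum n k (\<lambda>i j. (-1) ^ i * X i j) = 0"
    unfolding cullis_det_eq that by simp
  ultimately show ?thesis by blast
qed

section \<open>Systems of linear equations for matrices\<close>

definition unit_mat :: "nat \<Rightarrow> nat \<Rightarrow> nat \<Rightarrow> nat \<Rightarrow> 'a::zero_neq_one" where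
  "unit_mat i j = (\<lambda>r c. if r = i \<and> c = j then 1 else 0)"

text \<open>Linearity is asked on the whole function space, so that one functional can be evaluated
  on matrices of different sizes.\<close>

definition mat_functional :: "((nat \<Rightarrow> nat \<Rightarrow> 'a::field) \<Rightarrow> 'a) \<Rightarrow> bool" where
  "mat_functional f \<longleftrightarrow> (\<forall>X Y. f (X + Y) = f X + f Y) \<and> (\<forall>c X. f (mscale c X) = c * f X)"

text \<open>Taking \<open>\<lambda>_. 0\<close> for \<open>b\<close> gives the direction space of a
  nonempty solution set.\<close>

definition solutions ::
  "nat \<Rightarrow> nat \<Rightarrow> 't set \<Rightarrow> ('t \<Rightarrow> (nat \<Rightarrow> nat \<Rightarrow> 'a::field) \<Rightarrow> 'a) \<Rightarrow> ('t \<Rightarrow> 'a) \<Rightarrow> (nat \<Rightarrow> nat \<Rightarrow> 'a) set" where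
  "solutions n k T f b = {X \<in> mat_space n k. \<forall>t\<in>T. f t X = b t}"

interpretation mat: vector_space "mscale :: 'a::field \<Rightarrow> _"
  by (rule vector_space_mscale)

lemma sum_apply2: "(\<Sum>p\<in>A. F p) i j = (\<Sum>p\<in>A. F p i j)"
  by (induction A rule: infinite_finite_induct) auto

lemma mat_functional_add: "mat_functional f \<Longrightarrow> f (X + Y) = f X + f Y"
  and mat_functional_scale: "mat_functional f \<Longrightarrow> f (mscale c X) = c * f X"
  by (simp_all add: mat_functional_def)

lemma mat_functional_0: "mat_functional f \<Longrightarrow> f 0 = 0"
  by (metis mat_functional_add add_cancel_right_right add_0)

lemma mat_functional_diff: "mat_functional f \<Longrightarrow> f (X - Y) = f X - f Y"
  using mat_functional_add[of f "X - Y" Y] by (simp add: algebra_simps)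

lemma mat_functional_sum: "mat_functional f \<Longrightarrow> f (\<Sum>p\<in>A. F p) = (\<Sum>p\<in>A. f (F p))"
  by (induction A rule: infinite_finite_induct) (auto simp: mat_functional_0 mat_functional_add)

lemma mat_space_add: "X \<in> mat_space n k \<Longrightarrow> Y \<in> mat_space n k \<Longrightarrow> X + Y \<in> mat_space n k"
  and mat_space_scale: "X \<in> mat_space n k \<Longrightarrow> mscale c X \<in> mat_space n k"
  and mat_space_0: "(0 :: nat \<Rightarrow> nat \<Rightarrow> 'b::monoid_add) \<in> mat_space n k"
  for X Y :: "nat \<Rightarrow> nat \<Rightarrow> 'a::field"
  by (auto simp: mat_space_def mscale_def)

lemma mat_space_diff: "X \<in> mat_space n k \<Longrightarrow> Y \<in> mat_space n k \<Longrightarrow> X - Y \<in> mat_space n k"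
  for X Y :: "nat \<Rightarrow> nat \<Rightarrow> 'a::field"
  by (auto simp: mat_space_def)

lemma unit_mat_in_mat_space: "i \<in> {1..n} \<Longrightarrow> j \<in> {1..k} \<Longrightarrow> unit_mat i j \<in> mat_space n k"
  by (auto simp: mat_space_def unit_mat_def)

lemma subspace_mat_space: "mat.subspace (mat_space n k)"
  by (auto simp: mat.subspace_def mat_space_add mat_space_scale mat_space_0)

lemma mat_space_eq_sum:
  fixes X :: "nat \<Rightarrow> nat \<Rightarrow> 'a::field"
  assumes "X \<in> mat_space n k"
  shows "X = (\<Sum>(i, j)\<in>{1..n} \<times> {1..k}. mscale (X i j) (unit_mat i j))"
proof (intro ext)
  fix r c
  have "(\<Sum>(i, j)\<in>{1..n} \<times> {1..k}. mscale (X i j) (unit_mat i j)) r c =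
      (\<Sum>p\<in>{1..n} \<times> {1..k}. if p = (r, c) then X r c else 0)"
    unfolding sum_apply2 by (rule sum.cong) (auto simp: mscale_def unit_mat_def split: if_splits)
  also have "\<dots> = X r c"
    using assms by (subst sum.delta) (auto simp: mat_space_def)
  finally show "X r c = (\<Sum>(i, j)\<in>{1..n} \<times> {1..k}. mscale (X i j) (unit_mat i j)) r c" by simp
qed

lemma mat_functional_extend:
  assumes "mat.independent B"
  obtains \<phi> where "mat_functional \<phi>" "\<And>v. v \<in> B \<Longrightarrow> \<phi> v = h v"
proof -
  interpret f: vector_space "(*) :: 'a \<Rightarrow> 'a \<Rightarrow> 'a"
    by unfold_locales (auto simp: algebra_simps)
  interpret p: vector_space_pair "mscale :: 'a \<Rightarrow> _" "(*) :: 'a \<Rightarrow> 'a \<Rightarrow> 'a" ..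
  obtain \<phi> where lin: "Vector_Spaces.linear mscale (*) \<phi>" and \<phi>: "\<forall>v\<in>B. \<phi> v = h v"
    using p.linear_independent_extend[OF assms] by blast
  have "mat_functional \<phi>"
    unfolding mat_functional_def using p.linear_add[OF lin] p.linear_scale[OF lin] by blast
  with \<phi> that show thesis by blast
qed

lemma mat_functional_eq_0_on_span:
  assumes "mat_functional \<phi>" "\<And>v. v \<in> B \<Longrightarrow> \<phi> v = 0" and "v \<in> mat.span B"
  shows "\<phi> v = 0"
  using assms(3)
  by (induction rule: mat.span_induct_alt)
    (use assms(1,2) in \<open>simp_all add: mat_functional_0 mat_functional_add mat_functional_scale
        del: zero_fun_apply plus_fun_apply\<close>)

text \<open>A basis of \<open>W\<close> stays independent when \<open>x\<close> is added, so a
  functional can be prescribed to be 0 on the basis and 1 at \<open>x\<close>.\<close>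

lemma mat_separation:
  fixes x :: "nat \<Rightarrow> nat \<Rightarrow> 'a::field"
  assumes W: "mat.subspace W" and x: "x \<notin> W"
  obtains \<phi> where "mat_functional \<phi>" "\<And>v. v \<in> W \<Longrightarrow> \<phi> v = 0" "\<phi> x = 1"
proof -
  obtain B where B: "B \<subseteq> W" "mat.independent B" "W \<subseteq> mat.span B"
    by (rule mat.maximal_independent_subset)
  have span: "mat.span B = W"
    using B W by (simp add: mat.span_minimal subset_antisym)
  then have "mat.independent (insert x B)"
    using B x by (simp add: mat.independent_insertI)
  then obtain \<phi> where lin: "mat_functional \<phi>"
    and \<phi>: "\<And>v. v \<in> insert x B \<Longrightarrow> \<phi> v = (if v = x then 1 else 0)"
    by (rule mat_functional_extend[where h = "\<lambda>v. if v = x then 1 else 0"]) blast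
  have "\<phi> v = 0" if "v \<in> B" for v
    using that \<phi> x B(1) by auto
  then have "\<phi> v = 0" if "v \<in> W" for v
    using mat_functional_eq_0_on_span[OF lin] that span by blast
  moreover have "\<phi> x = 1" using \<phi> by simp
  ultimately show thesis using lin that by blast
qed

lemma underdetermined_system:
  fixes c :: "'t \<Rightarrow> 'j \<Rightarrow> 'a::field"
  assumes "finite T" "finite J" "card T < card J"
  obtains y where "\<exists>j\<in>J. y j \<noteq> 0" "\<And>t. t \<in> T \<Longrightarrow> (\<Sum>j\<in>J. y j * c t j) = 0"
proof -
  have "\<exists>y. (\<exists>j\<in>J. y j \<noteq> 0) \<and> (\<forall>t\<in>T. (\<Sum>j\<in>J. y j * c t j) = 0)"
    using assms
  proof (induction T arbitrary: J c rule: finite_induct)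
    case empty
    then have "\<exists>j\<in>J. (1 :: 'a) \<noteq> 0" by (auto simp: card_gt_0_iff)
    then show ?case by (intro exI[of _ "\<lambda>_. 1"]) simp
  next
    case (insert t T)
    show ?case
    proof (cases "\<exists>j0\<in>J. c t j0 \<noteq> 0")
      case False
      then have "(\<Sum>j\<in>J. y j * c t j) = 0" for y by (simp add: sum.neutral)
      moreover have "\<exists>y. (\<exists>j\<in>J. y j \<noteq> 0) \<and> (\<forall>t\<in>T. (\<Sum>j\<in>J. y j * c t j) = 0)"
        using insert by (intro insert.IH) auto
      ultimately show ?thesis by auto
    next
      case True
      then obtain j0 where j0: "j0 \<in> J" "c t j0 \<noteq> 0" by blast
      \<comment> \<open>Gaussian elimination: equation \<open>t\<close> is used to remove the
        unknown \<open>j0\<close> from all other equations.\<close>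
      let ?c = "\<lambda>u j. c u j - c t j / c t j0 * c u j0"
      have "\<exists>y. (\<exists>j\<in>J - {j0}. y j \<noteq> 0) \<and> (\<forall>u\<in>T. (\<Sum>j\<in>J - {j0}. y j * ?c u j) = 0)"
        using insert j0 by (intro insert.IH) auto
      then obtain y where y: "\<exists>j\<in>J - {j0}. y j \<noteq> 0"
        and 0: "\<And>u. u \<in> T \<Longrightarrow> (\<Sum>j\<in>J - {j0}. y j * ?c u j) = 0" by blast
      \<comment> \<open>The eliminated unknown is recovered by solving equation \<open>t\<close> for
        it.\<close>
      define s where "s = - (\<Sum>j\<in>J - {j0}. y j * c t j) / c t j0"
      let ?y = "y(j0 := s)"
      have split: "(\<Sum>j\<in>J. ?y j * d j) = s * d j0 + (\<Sum>j\<in>J - {j0}. y j * d j)" for d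
        using insert.prems(1) j0(1) by (subst sum.remove[of J j0]) (auto intro!: sum.cong)
      have "(\<Sum>j\<in>J. ?y j * c u j) = 0" if "u \<in> T" for u
      proof -
        have "(\<Sum>j\<in>J - {j0}. y j * ?c u j) =
            (\<Sum>j\<in>J - {j0}. y j * c u j) - (\<Sum>j\<in>J - {j0}. y j * c t j) / c t j0 * c u j0"
          by (simp add: right_diff_distrib sum_subtractf sum_divide_distrib sum_distrib_left
              sum_distrib_right mult_ac)
        then have "(\<Sum>j\<in>J - {j0}. y j * c u j) = (\<Sum>j\<in>J - {j0}. y j * c t j) / c t j0 * c u j0"
          using 0[OF that] by (metis eq_iff_diff_eq_0)
        moreover have "s * c u j0 = - ((\<Sum>j\<in>J - {j0}. y j * c t j) / c t j0 * c u j0)"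
          by (simp add: s_def)
        ultimately show ?thesis unfolding split by (simp only: left_minus)
      qed
      moreover have "(\<Sum>j\<in>J. ?y j * c t j) = 0"
        unfolding split using j0 by (simp add: s_def)
      moreover have "\<exists>j\<in>J. ?y j \<noteq> 0" using y by auto
      ultimately show ?thesis by (intro exI[of _ ?y]) auto
    qed
  qed
  then show thesis using that by blast
qed

text \<open>The \<open>j\<close>-th columns of the solutions form an affine subspace. If it misses
  the \<open>i\<close>-th unit vector, a functional vanishing on its direction but not on the
  displacement to that vector is a nontrivial functional constant on these columns.\<close>

lemma column_functional_if_not_attained:
  fixes f :: "'t \<Rightarrow> (nat \<Rightarrow> nat \<Rightarrow> 'a::field) \<Rightarrow> 'a"
  assumes lin: "\<And>t. t \<in> T \<Longrightarrow> mat_functional (f t)"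
    and X0: "X0 \<in> solutions n k T f b" and i: "i \<in> {1..n}" and j: "j \<in> {1..k}"
    and not: "\<And>X. X \<in> solutions n k T f b \<Longrightarrow> \<exists>r\<in>{1..n}. X r j \<noteq> (if r = i then 1 else 0)"
  obtains a \<beta> where "\<exists>r\<in>{1..n}. a r \<noteq> 0"
    "\<And>X. X \<in> solutions n k T f b \<Longrightarrow> (\<Sum>r=1..n. a r * X r j) = \<beta>"
proof -
  define V where "V = solutions n k T f (\<lambda>_. 0)"
  define cp :: "(nat \<Rightarrow> nat \<Rightarrow> 'a) \<Rightarrow> nat \<Rightarrow> nat \<Rightarrow> 'a"
    where "cp v = (\<lambda>r c. if c = j then v r c else 0)" for v
  have cp_add: "cp (v + w) = cp v + cp w" and cp_scale: "cp (mscale c v) = mscale c (cp v)" for v w c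
    by (auto simp: cp_def mscale_def fun_eq_iff)
  have V: "mat.subspace V"
    using lin by (auto simp: V_def solutions_def mat.subspace_def mat_space_0 mat_space_add
        mat_space_scale mat_functional_0 mat_functional_add mat_functional_scale)
  have W: "mat.subspace (cp ` V)"
    unfolding mat.subspace_def
  proof (intro conjI ballI allI)
    show "0 \<in> cp ` V" using mat.subspace_0[OF V] by (intro image_eqI[of _ _ 0]) (auto simp: cp_def fun_eq_iff)
    fix x assume "x \<in> cp ` V"
    then obtain v where v: "x = cp v" "v \<in> V" by blast
    show "mscale c x \<in> cp ` V" for c
      using mat.subspace_scale[OF V v(2), of c] by (auto simp: v(1) cp_scale[symmetric])
    fix y assume "y \<in> cp ` V"
    then obtain w where w: "y = cp w" "w \<in> V" by blast
    show "x + y \<in> cp ` V"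
      using mat.subspace_add[OF V v(2) w(2)] by (auto simp: v(1) w(1) cp_add[symmetric])
  qed
  \<comment> \<open>The displacement from column \<open>j\<close> of \<open>X0\<close> to the unit
    vector; if it came from \<open>v\<close> in \<open>V\<close>, the solution \<open>X0 + v\<close>
    would attain that vector.\<close>
  define e where "e = unit_mat i j - cp X0"
  have "e \<notin> cp ` V"
  proof
    assume "e \<in> cp ` V"
    then obtain v where v: "e = cp v" "v \<in> V" by blast
    have "X0 + v \<in> solutions n k T f b"
      using X0 v(2) lin by (auto simp: V_def solutions_def mat_space_add mat_functional_add)
    then obtain r where "r \<in> {1..n}" "(X0 + v) r j \<noteq> (if r = i then 1 else 0)" using not by blast
    moreover have "e r j = cp v r j" using v(1) by simp
    ultimately show False by (auto simp: e_def cp_def unit_mat_def algebra_simps split: if_splits)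
  qed
  then obtain \<phi> where \<phi>: "mat_functional \<phi>" and \<phi>0: "\<And>v. v \<in> cp ` V \<Longrightarrow> \<phi> v = 0" and \<phi>1: "\<phi> e = 1"
    by (rule mat_separation[OF W]) blast
  define a where "a r = \<phi> (unit_mat r j)" for r
  have val: "\<phi> (cp v) = (\<Sum>r=1..n. a r * v r j)" if "v \<in> mat_space n k" for v
  proof -
    have "cp v = (\<Sum>r\<in>{1..n}. mscale (v r j) (unit_mat r j))"
    proof (intro ext)
      fix r c
      have "(\<Sum>r\<in>{1..n}. mscale (v r j) (unit_mat r j)) r c =
          (\<Sum>r'\<in>{1..n}. if r' = r then cp v r c else 0)"
        unfolding sum_apply2 by (rule sum.cong) (auto simp: mscale_def unit_mat_def cp_def)
      also have "\<dots> = cp v r c"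
        using that by (subst sum.delta) (auto simp: mat_space_def cp_def)
      finally show "cp v r c = (\<Sum>r\<in>{1..n}. mscale (v r j) (unit_mat r j)) r c" by simp
    qed
    then show ?thesis
      by (simp add: mat_functional_sum[OF \<phi>] mat_functional_scale[OF \<phi>] a_def mult.commute)
  qed
  show thesis
  proof
    show "\<exists>r\<in>{1..n}. a r \<noteq> 0"
    proof (rule ccontr)
      assume "\<not> ?thesis"
      then have z: "\<phi> (cp v) = 0" if "v \<in> mat_space n k" for v using val[OF that] by simp
      have "e = cp (unit_mat i j - X0)" by (auto simp: e_def cp_def unit_mat_def fun_eq_iff)
      moreover have "unit_mat i j - X0 \<in> mat_space n k"
        using X0 i j by (auto simp: solutions_def intro!: mat_space_diff unit_mat_in_mat_space)
      ultimately show False using z \<phi>1 by simp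
    qed
    fix X assume X: "X \<in> solutions n k T f b"
    have "X - X0 \<in> V"
      using X X0 lin by (auto simp: V_def solutions_def mat_space_diff mat_functional_diff)
    then have "\<phi> (cp (X - X0)) = 0" "X - X0 \<in> mat_space n k"
      using \<phi>0 by (auto simp: V_def solutions_def)
    then have "(\<Sum>r=1..n. a r * (X - X0) r j) = 0" using val by simp
    then show "(\<Sum>r=1..n. a r * X r j) = (\<Sum>r=1..n. a r * X0 r j)"
      by (simp add: algebra_simps sum_subtractf)
  qed
qed

text \<open>Comparison of codimensions: at most \<open>k\<close> equations define the solution
  space, while the product of the \<open>k\<close> column kernels containing it has codimension
  exactly \<open>k\<close>.\<close>

lemma kernel_eq_product_of_kernels:
  fixes a :: "nat \<Rightarrow> nat \<Rightarrow> 'a::field"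
  assumes T: "finite T" "card T \<le> k" and lin: "\<And>t. t \<in> T \<Longrightarrow> mat_functional (f t)"
    and a: "\<And>j. j \<in> {1..k} \<Longrightarrow> \<exists>r\<in>{1..n}. a j r \<noteq> 0"
    and V: "\<And>v j. v \<in> solutions n k T f (\<lambda>_. 0) \<Longrightarrow> j \<in> {1..k} \<Longrightarrow> (\<Sum>r=1..n. a j r * v r j) = 0"
    and X: "X \<in> mat_space n k" "\<And>j. j \<in> {1..k} \<Longrightarrow> (\<Sum>r=1..n. a j r * X r j) = 0"
  shows "X \<in> solutions n k T f (\<lambda>_. 0)"
proof -
  obtain \<rho> where \<rho>: "\<And>j. j \<in> {1..k} \<Longrightarrow> \<rho> j \<in> {1..n} \<and> a j (\<rho> j) \<noteq> 0" using a by metis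
  \<comment> \<open>Besides \<open>X\<close>, one unit matrix per column at an entry where
    \<open>a j\<close> is nonzero. These \<open>k + 1\<close> matrices have a nontrivial combination
    \<open>Z\<close> satisfying the at most \<open>k\<close> equations; applying \<open>a j\<close>
    to column \<open>j\<close> isolates \<open>y j\<close>, so only the coefficient of
    \<open>X\<close> survives.\<close>
  define z where "z j = (if j = 0 then X else unit_mat (\<rho> j) j)" for j
  obtain y where y: "\<exists>j\<in>{0..k}. y j \<noteq> 0" and y0: "\<And>t. t \<in> T \<Longrightarrow> (\<Sum>j\<in>{0..k}. y j * f t (z j)) = 0"
    using underdetermined_system[of T "{0..k}" "\<lambda>t j. f t (z j)"] T by auto
  define Z where "Z = (\<Sum>j\<in>{0..k}. mscale (y j) (z j))"
  have zM: "z j \<in> mat_space n k" if "j \<in> {0..k}" for j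
    using that X(1) \<rho>[of j] by (auto simp: z_def intro!: unit_mat_in_mat_space)
  have "Z \<in> solutions n k T f (\<lambda>_. 0)"
    unfolding solutions_def
  proof (intro CollectI conjI ballI)
    show "Z \<in> mat_space n k"
      unfolding Z_def using zM
      by (intro mat.subspace_sum[OF subspace_mat_space] mat_space_scale)
    show "f t Z = 0" if "t \<in> T" for t
      using y0[OF that] lin[OF that] by (simp add: Z_def mat_functional_sum mat_functional_scale)
  qed
  note ZV = V[OF this]
  have Zval: "Z r c = y 0 * X r c + (if r = \<rho> c then y c else 0)" if "c \<in> {1..k}" for r c
  proof -
    have "Z r c = (\<Sum>j\<in>{0..k}. y j * z j r c)" by (simp add: Z_def sum_apply2 mscale_def)
    also have "\<dots> = y 0 * X r c + (\<Sum>j\<in>{1..k}. y j * z j r c)"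
      by (subst sum.atLeast_Suc_atMost) (auto simp: z_def)
    also have "(\<Sum>j\<in>{1..k}. y j * z j r c) = (\<Sum>j\<in>{1..k}. if j = c then (if r = \<rho> c then y c else 0) else 0)"
      by (rule sum.cong) (auto simp: z_def unit_mat_def)
    also have "\<dots> = (if r = \<rho> c then y c else 0)"
      using that by (subst sum.delta) auto
    finally show ?thesis .
  qed
  have yj: "y j = 0" if j: "j \<in> {1..k}" for j
  proof -
    have "0 = (\<Sum>r=1..n. a j r * Z r j)" using ZV[OF j] by simp
    also have "\<dots> = (\<Sum>r=1..n. y 0 * (a j r * X r j) + (if r = \<rho> j then a j r * y j else 0))"
      by (rule sum.cong) (auto simp: Zval[OF j] algebra_simps)
    also have "\<dots> = y 0 * (\<Sum>r=1..n. a j r * X r j) + (\<Sum>r=1..n. if r = \<rho> j then a j r * y j else 0)"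
      by (simp add: sum.distrib sum_distrib_left)
    also have "\<dots> = a j (\<rho> j) * y j"
      using X(2)[OF j] \<rho>[OF j] by (subst sum.delta) auto
    finally show ?thesis using \<rho>[OF j] by simp
  qed
  have "y 0 \<noteq> 0"
  proof
    assume "y 0 = 0"
    then have "y j = 0" if "j \<in> {0..k}" for j using yj[of j] that by (cases j) auto
    then show False using y by blast
  qed
  moreover have "y 0 * f t X = 0" if "t \<in> T" for t
  proof -
    have "(\<Sum>j\<in>{0..k}. y j * f t (z j)) = y 0 * f t X + (\<Sum>j\<in>{1..k}. y j * f t (z j))"
      by (subst sum.atLeast_Suc_atMost) (auto simp: z_def)
    then show ?thesis using y0[OF that] yj by simp
  qed
  ultimately show ?thesis using X(1) by (simp add: solutions_def)
qed

section \<open>The sum of maximal minors of a matrix\<close>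

lemma maximal_minor_sum_cong:
  assumes "\<And>i j. i \<in> {1..n} \<Longrightarrow> j \<in> {1..k} \<Longrightarrow> X i j = Y i j"
  shows "maximal_minor_sum n k X = maximal_minor_sum n k Y"
  unfolding maximal_minor_sum_def
  by (rule minor_sum_cong) (use assms in \<open>auto simp: list_all2_conv_all_nth nth_append\<close>)

lemma maximal_minor_sum_eq_det_k:
  assumes "k \<le> n" and "\<And>i j. i \<in> {Suc k..n} \<Longrightarrow> j \<in> {1..k} \<Longrightarrow> X i j = 0"
  shows "maximal_minor_sum n k X = det_k k X"
proof -
  \<comment> \<open>The rows after \<open>k\<close> become zero in all columns, including those
    outside \<open>{1..k}\<close>, as \<open>minor_sum_zeros\<close> requires.\<close>
  define Y where "Y i = (if i \<le> k then X i else 0)" for i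
  have "[1..<Suc n] = [1..<Suc k] @ [Suc k..<Suc n]"
    using assms(1) upt_add_eq_append[of 1 "Suc k" "n - k"] by simp
  moreover have "map Y [Suc k..<Suc n] = replicate (n - k) 0"
    by (intro nth_equalityI) (auto simp: Y_def nth_append)
  ultimately have "map Y [1..<Suc n] = map Y [1..<Suc k] @ replicate (n - k) 0" by simp
  then have "maximal_minor_sum n k Y = minor_sum k [] (map Y [1..<Suc k])"
    unfolding maximal_minor_sum_def by (simp only: minor_sum_zeros)
  also have "\<dots> = det_rows k (map Y [1..<Suc k])"
    by (subst minor_sum_full) auto
  also have "\<dots> = det_k k X"
    unfolding det_rows_def by (rule det_k_cong) (auto simp: Y_def nth_append less_Suc_eq_le simp del: upt_Suc)
  also have "maximal_minor_sum n k Y = maximal_minor_sum n k X"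
    by (rule maximal_minor_sum_cong) (use assms in \<open>auto simp: Y_def\<close>)
  finally show ?thesis .
qed

lemma maximal_minor_sum_identity:
  assumes "k \<le> n"
  shows "maximal_minor_sum n k (\<lambda>i j. if i = j then 1 else 0) = 1"
proof (cases "k = 0")
  case True
  then show ?thesis by (subst maximal_minor_sum_eq_det_k) (auto simp: det_k_def)
next
  case False
  have "maximal_minor_sum n k (\<lambda>i j. if i = j then 1 else 0) =
      det_k k (\<lambda>i j. if i = j then 1 else (0 :: 'a))"
    by (rule maximal_minor_sum_eq_det_k) (use assms in auto)
  also have "\<dots> = det_k k (\<lambda>i j. if i = 1 then (if j = 1 then 1 else 0) else if i = j then 1 else 0)"
    by (rule det_k_cong) auto
  also have "\<dots> = 1"
    using False by (subst det_k_identity_replace_row) auto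
  finally show ?thesis .
qed

lemma maximal_minor_sum_cancel:
  assumes i: "i \<in> {1..<n}" and X: "\<And>j. j \<in> {1..k} \<Longrightarrow> X (Suc i) j = - X i j"
  shows "maximal_minor_sum n k X = maximal_minor_sum (n - 2) k (\<lambda>r. if r < i then X r else X (r + 2))"
proof -
  \<comment> \<open>\<open>Y\<close> makes the relation between the two rows hold as an equation of
    functions, not only on the columns \<open>{1..k}\<close>.\<close>
  define Y where "Y = X(Suc i := - X i)"
  have split: "[1..<Suc n] = [1..<i] @ i # Suc i # [i + 2..<Suc n]"
    using i upt_add_eq_append[of 1 i "Suc n - i"] by (simp add: upt_conv_Cons)
  have split2: "[1..<Suc (n - 2)] = [1..<i] @ [i..<Suc (n - 2)]"
  proof -
    have eq: "Suc (n - 2) = n - 1" using i by auto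
    show ?thesis
      unfolding eq using i upt_add_eq_append[of 1 i "n - 1 - i"] by simp
  qed
  have "maximal_minor_sum n k X = maximal_minor_sum n k Y"
    by (rule maximal_minor_sum_cong) (auto simp: Y_def X)
  also have "\<dots> = minor_sum k [] (map Y [1..<i] @ Y i # Y (Suc i) # map Y [i + 2..<Suc n])"
    unfolding maximal_minor_sum_def split by simp
  also have "\<dots> = minor_sum k [] (map Y [1..<i] @ map Y [i + 2..<Suc n])"
    by (rule minor_sum_cancel) (simp add: Y_def)
  also have "map Y [1..<i] @ map Y [i + 2..<Suc n] =
      map (\<lambda>r. if r < i then X r else X (r + 2)) [1..<Suc (n - 2)]"
    unfolding split2 map_append
  proof (rule arg_cong2[where f = "(@)"])
    show "map Y [1..<i] = map (\<lambda>r. if r < i then X r else X (r + 2)) [1..<i]"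
      by (auto simp: Y_def)
    show "map Y [i + 2..<Suc n] = map (\<lambda>r. if r < i then X r else X (r + 2)) [i..<Suc (n - 2)]"
      using i by (intro nth_equalityI) (auto simp: Y_def simp del: upt_Suc)
  qed
  finally show ?thesis unfolding maximal_minor_sum_def .
qed

text \<open>Matrix form of \<open>minor_sum_last_column\<close>: row \<open>i\<close> disappears,
  the rows above it change sign, and those below move up by one.\<close>

lemma maximal_minor_sum_last_column:
  assumes i: "i \<in> {1..n}" and X: "\<And>r. r \<in> {1..n} \<Longrightarrow> r \<noteq> i \<Longrightarrow> X r (Suc k) = 0"
  shows "maximal_minor_sum n (Suc k) X = (-1) ^ k * X i (Suc k)
    * maximal_minor_sum (n - 1) k (\<lambda>r j. if r < i then - X r j else X (Suc r) j)"
proof -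
  have split: "[1..<Suc n] = [1..<i] @ i # [Suc i..<Suc n]"
    using i upt_add_eq_append[of 1 i "Suc n - i"] by (simp add: upt_conv_Cons)
  have split2: "[1..<Suc (n - 1)] = [1..<i] @ [i..<Suc (n - 1)]"
    using i upt_add_eq_append[of 1 i "Suc (n - 1) - i"] by simp
  have "maximal_minor_sum n (Suc k) X
      = minor_sum (Suc k) [] (map X [1..<i] @ X i # map X [Suc i..<Suc n])"
    unfolding maximal_minor_sum_def split by simp
  also have "\<dots> = (-1) ^ (k - length ([] :: (nat \<Rightarrow> 'a) list)) * X i (Suc k)
      * minor_sum k [] (map (\<lambda>r j. - r j) (map X [1..<i]) @ map X [Suc i..<Suc n])"
    by (rule minor_sum_last_column) (use X i in \<open>auto simp: fun_eq_iff\<close>)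
  also have "map (\<lambda>r j. - r j) (map X [1..<i]) @ map X [Suc i..<Suc n] =
      map (\<lambda>r j. if r < i then - X r j else X (Suc r) j) [1..<Suc (n - 1)]"
    unfolding split2 map_append
  proof (rule arg_cong2[where f = "(@)"])
    show "map X [Suc i..<Suc n] = map (\<lambda>r j. if r < i then - X r j else X (Suc r) j) [i..<Suc (n - 1)]"
      using i by (intro nth_equalityI) (auto simp del: upt_Suc)
  qed auto
  finally show ?thesis by (simp add: maximal_minor_sum_def)
qed

lemma maximal_minor_sum_mult:
  "maximal_minor_sum n k (\<lambda>i j. \<Sum>l\<in>{1..k}. X i l * g l j) = maximal_minor_sum n k X * det_k k g"
  using minor_sum_map_mult[of k g "[]" "map X [1..<Suc n]"]
  unfolding maximal_minor_sum_def map_map list.map(1) o_def .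

lemma sum_list_map_upt: "sum_list (map X [1..<Suc n]) j = (\<Sum>i = 1..n. X i j)"
  by (induction n) auto

lemma maximal_minor_sum_odd:
  assumes "odd k" and "\<And>j. j \<in> {1..k} \<Longrightarrow> (\<Sum>i = 1..n. X i j) = 0"
  shows "maximal_minor_sum n k X = 0"
proof -
  define Y where "Y i j = (if j \<in> {1..k} then X i j else 0)" for i j
  have "maximal_minor_sum n k X = maximal_minor_sum n k Y"
    by (rule maximal_minor_sum_cong) (auto simp: Y_def)
  also have "\<dots> = 0"
    unfolding maximal_minor_sum_def
  proof (rule minor_sum_odd[OF assms(1)], rule ext)
    show "sum_list (map Y [1..<Suc n]) j = 0 j" for j
      unfolding sum_list_map_upt using assms(2)[of j] by (cases "j \<in> {1..k}") (auto simp: Y_def)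
  qed
  finally show ?thesis .
qed

text \<open>The witness is a padded identity block preceded by minus the sum of its rows; by
  \<open>minor_sum_even\<close> this first row does not change the form.\<close>

lemma maximal_minor_sum_even_nonzero:
  assumes "even k" and "k < n"
  obtains X :: "nat \<Rightarrow> nat \<Rightarrow> 'a::field" where "X \<in> mat_space n k"
    "\<And>j. j \<in> {1..k} \<Longrightarrow> (\<Sum>i = 1..n. X i j) = 0" "maximal_minor_sum n k X \<noteq> 0"
proof
  define X :: "nat \<Rightarrow> nat \<Rightarrow> 'a" where
    "X i j = (if j \<in> {1..k} then if i = 1 then - 1 else if i = Suc j then 1 else 0 else 0)" for i j
  show "X \<in> mat_space n k" using assms(2) by (auto simp: X_def mat_space_def)
  have split: "map X [1..<Suc n] = X 1 # map (\<lambda>i. X (Suc i)) [1..<Suc (n - 1)]"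
    using assms(2) by (simp add: upt_conv_Cons map_Suc_upt[symmetric] del: upt_Suc)
  have tail: "(\<Sum>i = 1..n - 1. X (Suc i) j) = (if j \<in> {1..k} then 1 else 0)" for j
  proof -
    have "(\<Sum>i = 1..n - 1. X (Suc i) j) = (\<Sum>i = 1..n - 1. if i = j then (if j \<in> {1..k} then 1 else 0) else 0)"
      by (rule sum.cong) (auto simp: X_def)
    then show ?thesis using assms(2) by auto
  qed
  have X1: "X 1 = - sum_list (map (\<lambda>i. X (Suc i)) [1..<Suc (n - 1)])"
    by (rule ext, simp only: uminus_apply sum_list_map_upt tail) (simp add: X_def)
  show "(\<Sum>i = 1..n. X i j) = 0" if "j \<in> {1..k}" for j
  proof -
    have "(\<Sum>i = 1..n. X i j) = sum_list (map X [1..<Suc n]) j"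
      by (rule sum_list_map_upt[symmetric])
    also have "\<dots> = 0" unfolding split X1 by simp
    finally show ?thesis .
  qed
  have "maximal_minor_sum n k X = minor_sum k [] (map (\<lambda>i. X (Suc i)) [1..<Suc (n - 1)])"
    unfolding maximal_minor_sum_def split X1 by (rule minor_sum_even[OF assms(1)])
  also have "\<dots> = maximal_minor_sum (n - 1) k (\<lambda>i. X (Suc i))"
    by (simp only: maximal_minor_sum_def)
  also have "\<dots> = maximal_minor_sum (n - 1) k (\<lambda>i j. if i = j then 1 else 0)"
    by (rule maximal_minor_sum_cong) (auto simp: X_def)
  also have "\<dots> = 1" by (rule maximal_minor_sum_identity) (use assms(2) in auto)
  finally show "maximal_minor_sum n k X \<noteq> 0" by simp
qed

section \<open>Vanishing on the solutions of few equations\<close>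

definition zero_sum_mats :: "nat \<Rightarrow> nat \<Rightarrow> (nat \<Rightarrow> nat \<Rightarrow> 'a::comm_monoid_add) set" where
  "zero_sum_mats n k = {X \<in> mat_space n k. \<forall>j\<in>{1..k}. (\<Sum>i = 1..n. X i j) = 0}"

text \<open>The number of equations is bounded by \<open>k\<close> rather than fixed, and they may
  be dependent, so that eliminating one equation leads directly to an instance for
  \<open>k - 1\<close>.\<close>

definition vanishing_system ::
  "nat \<Rightarrow> nat \<Rightarrow> 't set \<Rightarrow> ('t \<Rightarrow> (nat \<Rightarrow> nat \<Rightarrow> 'a::field) \<Rightarrow> 'a) \<Rightarrow> ('t \<Rightarrow> 'a) \<Rightarrow> bool" where
  "vanishing_system n k T f b \<longleftrightarrow> k + 2 \<le> n \<and> finite T \<and> card T \<le> k \<and>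
    (\<forall>t\<in>T. mat_functional (f t)) \<and> solutions n k T f b \<noteq> {} \<and>
    (\<forall>X\<in>solutions n k T f b. maximal_minor_sum n k X = 0)"

lemma mat_functional_eq_0_on_mat_space:
  assumes "mat_functional \<phi>" "\<And>i j. i \<in> {1..n} \<Longrightarrow> j \<in> {1..k} \<Longrightarrow> \<phi> (unit_mat i j) = 0"
    and "X \<in> mat_space n k"
  shows "\<phi> X = 0"
  by (subst mat_space_eq_sum[OF assms(3)])
    (use assms(1,2) in \<open>auto simp: mat_functional_sum mat_functional_scale split_def intro!: sum.neutral\<close>)

lemma solutions_add:
  assumes "\<And>t. t \<in> T \<Longrightarrow> mat_functional (f t)"
    and "X \<in> solutions n k T f b" "v \<in> solutions n k T f (\<lambda>_. 0)"
  shows "X + v \<in> solutions n k T f b"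
  using assms by (auto simp: solutions_def mat_space_add mat_functional_add)

lemma solutions_diff:
  assumes "\<And>t. t \<in> T \<Longrightarrow> mat_functional (f t)"
    and "X \<in> solutions n k T f b" "Y \<in> solutions n k T f b"
  shows "X - Y \<in> solutions n k T f (\<lambda>_. 0)"
  using assms by (auto simp: solutions_def mat_space_diff mat_functional_diff)

text \<open>Expanding along the last column deletes row \<open>i\<close>, so the entry
  \<open>(i, j)\<close> does not affect the form and may be used to satisfy equation
  \<open>t0\<close>. The remaining matrix, with its sign changes, then obeys one equation fewer, and
  the induction hypothesis for \<open>k\<close> applies.\<close>

lemma pivot_reduction:
  fixes f :: "'t \<Rightarrow> (nat \<Rightarrow> nat \<Rightarrow> 'a::field) \<Rightarrow> 'a"
  assumes IH: "\<forall>n (T :: 't set) (f :: 't \<Rightarrow> (nat \<Rightarrow> nat \<Rightarrow> 'a) \<Rightarrow> 'a) b. vanishing_system n k T f b \<longrightarrow>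
      odd k \<and> solutions n k T f b = zero_sum_mats n k"
    and sys: "vanishing_system n (Suc k) T f b"
    and t0: "t0 \<in> T" "f t0 (unit_mat i j) \<noteq> 0" and i: "i \<in> {1..n}" and j: "j \<in> {1..k}"
    and X: "X \<in> solutions n (Suc k) T f b"
    and col: "\<And>r. r \<in> {1..n} \<Longrightarrow> X r (Suc k) = (if r = i then 1 else 0)"
  shows "odd k" and "\<And>m. m \<in> {1..k} \<Longrightarrow> (\<Sum>r = 1..n - 1. if r < i then - X r m else X (Suc r) m) = 0"
proof -
  have n: "k + 3 \<le> n" and T: "finite T" "card T \<le> Suc k" and lin: "\<And>t. t \<in> T \<Longrightarrow> mat_functional (f t)"
    and vanish: "\<And>X. X \<in> solutions n (Suc k) T f b \<Longrightarrow> maximal_minor_sum n (Suc k) X = 0"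
    using sys by (auto simp: vanishing_system_def)
  define E :: "nat \<Rightarrow> nat \<Rightarrow> 'a" where "E = unit_mat i j"
  \<comment> \<open>\<open>emb\<close> undoes the deletion: it reinserts a zero row \<open>i\<close>
    and reverts signs and shifts. \<open>Y0\<close> is the reduced form of \<open>X\<close>.\<close>
  define emb :: "(nat \<Rightarrow> nat \<Rightarrow> 'a) \<Rightarrow> nat \<Rightarrow> nat \<Rightarrow> 'a" where
    "emb Y = (\<lambda>r c. if c \<in> {1..k} then (if r = i then 0 else if r < i then - Y r c else Y (r - 1) c) else 0)" for Y
  define Y0 :: "nat \<Rightarrow> nat \<Rightarrow> 'a" where
    "Y0 = (\<lambda>r c. if r \<in> {1..n - 1} \<and> c \<in> {1..k} then (if r < i then - X r c else X (Suc r) c) else 0)"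
  \<comment> \<open>Equation \<open>t\<close> after elimination of the entry \<open>(i, j)\<close>
    by means of \<open>t0\<close>.\<close>
  define g where "g t Y = f t (emb Y) - f t E / f t0 E * f t0 (emb Y)" for t Y
  have emb_add: "emb (Y + Z) = emb Y + emb Z" and emb_scale: "emb (mscale c Y) = mscale c (emb Y)"
    and emb_diff: "emb (Y - Z) = emb Y - emb Z" for Y Z c
    by (auto simp: emb_def mscale_def fun_eq_iff)
  have emb_M: "emb Y \<in> mat_space n (Suc k)" if "Y \<in> mat_space (n - 1) k" for Y
  proof -
    have "Y (r - 1) c = 0" if "n < r" for r c
    proof -
      have "r - 1 \<notin> {1..n - 1}" using that n by auto
      then show ?thesis using \<open>Y \<in> mat_space (n - 1) k\<close> unfolding mat_space_def by blast
    qed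
    then show ?thesis using that i by (auto simp: emb_def mat_space_def)
  qed
  have E_M: "E \<in> mat_space n (Suc k)"
    unfolding E_def using i j by (intro unit_mat_in_mat_space) auto
  have Y0_M: "Y0 \<in> mat_space (n - 1) k" by (auto simp: Y0_def mat_space_def)
  have g: "mat_functional (g t)" if "t \<in> T" for t
    using lin[OF that] lin[OF t0(1)] unfolding mat_functional_def g_def emb_add emb_scale
    by (auto simp: algebra_simps)
  let ?b = "\<lambda>t. g t Y0"
  have Y0: "Y0 \<in> solutions (n - 1) k (T - {t0}) g ?b"
    using Y0_M by (simp add: solutions_def)
  have vanish': "maximal_minor_sum (n - 1) k Y = 0" if Y: "Y \<in> solutions (n - 1) k (T - {t0}) g ?b" for Y
  proof -
    have YM: "Y \<in> mat_space (n - 1) k" using Y by (simp add: solutions_def)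
    define D where "D = emb (Y - Y0)"
    \<comment> \<open>The multiple of \<open>E\<close> that restores equation \<open>t0\<close>
      after the change by \<open>D\<close>.\<close>
    define \<zeta> where "\<zeta> = - f t0 D / f t0 E"
    define X' where "X' = X + (D + mscale \<zeta> E)"
    have DM: "D \<in> mat_space n (Suc k)"
      unfolding D_def by (intro emb_M mat_space_diff YM Y0_M)
    have "f t D + \<zeta> * f t E = 0" if t: "t \<in> T" for t
    proof (cases "t = t0")
      case True
      then show ?thesis using t0(2) by (simp add: \<zeta>_def E_def)
    next
      case False
      then have "g t Y = g t Y0" using Y t by (simp add: solutions_def)
      then have "g t (Y - Y0) = 0" by (simp add: mat_functional_diff[OF g[OF t]])
      then show ?thesis by (simp add: g_def D_def[symmetric] \<zeta>_def mult.commute)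
    qed
    then have "D + mscale \<zeta> E \<in> solutions n (Suc k) T f (\<lambda>_. 0)"
      using lin DM E_M
      by (auto simp: solutions_def mat_functional_add mat_functional_scale intro!: mat_space_add mat_space_scale)
    from solutions_add[OF lin X this] have "X' \<in> solutions n (Suc k) T f b"
      by (simp only: X'_def)
    then have "0 = maximal_minor_sum n (Suc k) X'" using vanish by simp
    also have "\<dots> = (-1) ^ k * X' i (Suc k)
        * maximal_minor_sum (n - 1) k (\<lambda>r j. if r < i then - X' r j else X' (Suc r) j)"
      by (rule maximal_minor_sum_last_column[OF i])
        (use col j in \<open>auto simp: X'_def D_def emb_def E_def unit_mat_def mscale_def\<close>)
    also have "X' i (Suc k) = 1"
      using col i j by (auto simp: X'_def D_def emb_def E_def unit_mat_def mscale_def)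
    also have "maximal_minor_sum (n - 1) k (\<lambda>r j. if r < i then - X' r j else X' (Suc r) j)
        = maximal_minor_sum (n - 1) k Y"
      by (rule maximal_minor_sum_cong)
        (use i in \<open>auto simp: X'_def D_def emb_def E_def unit_mat_def mscale_def Y0_def\<close>)
    finally show ?thesis by simp
  qed
  have "vanishing_system (n - 1) k (T - {t0}) g ?b"
    unfolding vanishing_system_def
    using n T t0(1) g vanish' Y0 by auto
  with IH Y0 have *: "odd k" "Y0 \<in> zero_sum_mats (n - 1) k" by blast+
  then show "odd k" by simp
  show "(\<Sum>r = 1..n - 1. if r < i then - X r m else X (Suc r) m) = 0" if m: "m \<in> {1..k}" for m
  proof -
    have "(\<Sum>r = 1..n - 1. if r < i then - X r m else X (Suc r) m) = (\<Sum>r = 1..n - 1. Y0 r m)"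
      by (rule sum.cong) (use m in \<open>auto simp: Y0_def\<close>)
    then show ?thesis using *(2) m by (simp add: zero_sum_mats_def)
  qed
qed

text \<open>Otherwise every unit vector occurs as a last column. Applying
  \<open>pivot_reduction\<close> for all rows forces the homogeneous solutions with zero last column
  to have rows that alternate in sign, which is too rigid for at most \<open>k + 1\<close>
  equations.\<close>

lemma last_column_functional:
  fixes f :: "'t \<Rightarrow> (nat \<Rightarrow> nat \<Rightarrow> 'a::field) \<Rightarrow> 'a"
  assumes IH: "\<forall>n (T :: 't set) (f :: 't \<Rightarrow> (nat \<Rightarrow> nat \<Rightarrow> 'a) \<Rightarrow> 'a) b. vanishing_system n k T f b \<longrightarrow>
      odd k \<and> solutions n k T f b = zero_sum_mats n k"
    and sys: "vanishing_system n (Suc k) T f b"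
  shows "\<exists>a \<beta>. (\<exists>r\<in>{1..n}. a r \<noteq> 0) \<and>
    (\<forall>X\<in>solutions n (Suc k) T f b. (\<Sum>r = 1..n. a r * X r (Suc k)) = \<beta>)"
proof (rule ccontr)
  assume neg: "\<not> ?thesis"
  have n: "k + 3 \<le> n" and T: "finite T" "card T \<le> Suc k" and lin: "\<And>t. t \<in> T \<Longrightarrow> mat_functional (f t)"
    and vanish: "\<And>X. X \<in> solutions n (Suc k) T f b \<Longrightarrow> maximal_minor_sum n (Suc k) X = 0"
    using sys by (auto simp: vanishing_system_def)
  obtain X0 where X0: "X0 \<in> solutions n (Suc k) T f b" using sys by (auto simp: vanishing_system_def)
  have attained: "\<exists>X\<in>solutions n (Suc k) T f b. \<forall>r\<in>{1..n}. X r (Suc k) = (if r = i then 1 else 0)"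
    if i: "i \<in> {1..n}" for i
  proof (rule ccontr)
    assume "\<not> ?thesis"
    then have not: "\<exists>r\<in>{1..n}. X r (Suc k) \<noteq> (if r = i then 1 else 0)"
      if "X \<in> solutions n (Suc k) T f b" for X using that by blast
    show False
      by (rule column_functional_if_not_attained[OF lin X0 i _ not]) (use neg in auto)
  qed
  show False
  proof (cases "\<exists>t0\<in>T. \<exists>i\<in>{1..n}. \<exists>j\<in>{1..k}. f t0 (unit_mat i j) \<noteq> 0")
    case False
    have "1 \<in> {1..n}" using n by auto
    from attained[OF this] obtain X where X: "X \<in> solutions n (Suc k) T f b"
      and col: "\<And>r. r \<in> {1..n} \<Longrightarrow> X r (Suc k) = (if r = 1 then 1 else 0)" by blast
    \<comment> \<open>No equation sees the first \<open>k\<close> columns, so they may be filled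
      with an identity block in rows \<open>2\<close> to \<open>k + 1\<close>; the form is then a
      sign.\<close>
    define X' where "X' r c = (if c = Suc k then X r c else if c \<in> {1..k} \<and> r = Suc c then 1 else 0)" for r c
    have XM: "X \<in> mat_space n (Suc k)" using X by (simp add: solutions_def)
    have diff: "X' - X \<in> mat_space n k"
      using XM n by (auto simp: mat_space_def X'_def)
    have "f t (X' - X) = 0" if "t \<in> T" for t
      by (rule mat_functional_eq_0_on_mat_space[OF lin[OF that] _ diff]) (use False that in blast)
    moreover have "X' - X \<in> mat_space n (Suc k)" using diff by (auto simp: mat_space_def)
    ultimately have "X' - X \<in> solutions n (Suc k) T f (\<lambda>_. 0)" by (simp add: solutions_def)
    from solutions_add[OF lin X this] have "X' \<in> solutions n (Suc k) T f b" by simp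
    then have "0 = maximal_minor_sum n (Suc k) X'" using vanish by simp
    also have "\<dots> = (-1) ^ k * X' 1 (Suc k)
        * maximal_minor_sum (n - 1) k (\<lambda>r j. if r < 1 then - X' r j else X' (Suc r) j)"
      by (rule maximal_minor_sum_last_column) (use n col in \<open>auto simp: X'_def\<close>)
    also have "maximal_minor_sum (n - 1) k (\<lambda>r j. if r < 1 then - X' r j else X' (Suc r) j)
        = maximal_minor_sum (n - 1) k (\<lambda>r j. if r = j then 1 else 0)"
      by (rule maximal_minor_sum_cong) (auto simp: X'_def)
    also have "\<dots> = 1" by (rule maximal_minor_sum_identity) (use n in auto)
    also have "X' 1 (Suc k) = 1" using col n by (auto simp: X'_def)
    finally show False by simp
  next
    case True
    then obtain i0 j0 where i0: "i0 \<in> {1..n}" and j0: "j0 \<in> {1..k}"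
      and piv0: "\<exists>t0\<in>T. f t0 (unit_mat i0 j0) \<noteq> 0" by blast
    \<comment> \<open>\<open>\<sigma> i\<close> is the column sum that
      \<open>pivot_reduction\<close> makes vanish for solutions with last column the
      \<open>i\<close>-th unit vector. Two such solutions differ by an element of \<open>V0\<close>,
      so it vanishes there too.\<close>
    define \<sigma> where "\<sigma> i v m = (\<Sum>r = 1..n - 1. if r < i then - v r m else v (Suc r) m)"
      for i m and v :: "nat \<Rightarrow> nat \<Rightarrow> 'a"
    define V0 where "V0 = {v \<in> solutions n (Suc k) T f (\<lambda>_. 0). \<forall>r. v r (Suc k) = 0}"
    have \<sigma>: "odd k \<and> \<sigma> i v m = 0" if piv: "\<exists>t0\<in>T. f t0 (unit_mat i j0) \<noteq> 0" and i: "i \<in> {1..n}"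
      and v: "v \<in> V0" and m: "m \<in> {1..k}" for i v m
    proof -
      obtain t0 where t0: "t0 \<in> T" "f t0 (unit_mat i j0) \<noteq> 0" using piv by blast
      obtain X where X: "X \<in> solutions n (Suc k) T f b"
        and col: "\<And>r. r \<in> {1..n} \<Longrightarrow> X r (Suc k) = (if r = i then 1 else 0)" using attained[OF i] by blast
      have Xv: "X + v \<in> solutions n (Suc k) T f b"
        using v by (intro solutions_add[OF lin X]) (auto simp: V0_def)
      have colv: "(X + v) r (Suc k) = (if r = i then 1 else 0)" if "r \<in> {1..n}" for r
        using col[OF that] v by (simp add: V0_def)
      note red = pivot_reduction[OF IH sys t0 i j0]
      have "\<sigma> i X m = 0" unfolding \<sigma>_def by (rule red(2)[OF X col m])
      moreover have "\<sigma> i (X + v) m = 0" unfolding \<sigma>_def by (rule red(2)[OF Xv colv m])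
      moreover have "\<sigma> i (X + v) m = \<sigma> i X m + \<sigma> i v m"
        unfolding \<sigma>_def sum.distrib[symmetric] by (rule sum.cong) auto
      moreover have "odd k" by (rule red(1)[OF X col])
      ultimately show ?thesis by simp
    qed
    have zero_V0: "0 \<in> V0"
      using lin by (auto simp: V0_def solutions_def mat_space_0 mat_functional_0)
    have "odd k" using \<sigma>[OF piv0 i0 zero_V0 j0] by simp
    then have k: "1 \<le> k" by (cases k) auto
    \<comment> \<open>If no equation sees the entry \<open>(i, j0)\<close>, its unit matrix lies in
      \<open>V0\<close>; but \<open>\<sigma> i0\<close> takes the value 1 or -1 on it.\<close>
    have piv: "\<exists>t0\<in>T. f t0 (unit_mat i j0) \<noteq> 0" if i: "i \<in> {1..n}" for i
    proof (rule ccontr)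
      assume no: "\<not> ?thesis"
      then have "i \<noteq> i0" using piv0 by auto
      have "unit_mat i j0 \<in> V0"
        using no i j0 by (auto simp: V0_def solutions_def unit_mat_def intro!: unit_mat_in_mat_space[unfolded unit_mat_def])
      then have "\<sigma> i0 (unit_mat i j0) j0 = 0" using \<sigma>[OF piv0 i0 _ j0] by blast
      moreover have "\<sigma> i0 (unit_mat i j0) j0 =
          (\<Sum>r = 1..n - 1. if r = (if i < i0 then i else i - 1) then (if i < i0 then - 1 else 1) else 0)"
        unfolding \<sigma>_def by (rule sum.cong) (use \<open>i \<noteq> i0\<close> i in \<open>auto simp: unit_mat_def\<close>)
      moreover have "(if i < i0 then i else i - 1) \<in> {1..n - 1}" using i i0 \<open>i \<noteq> i0\<close> by auto
      ultimately show False by (auto split: if_splits)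
    qed
    \<comment> \<open>Consecutive sums \<open>\<sigma> i\<close> and \<open>\<sigma> (Suc i)\<close>
      treat all rows alike except rows \<open>i\<close> and \<open>Suc i\<close>.\<close>
    have step: "v (Suc i) m = - v i m" if v: "v \<in> V0" and i: "i \<in> {1..<n}" and m: "m \<in> {1..k}" for v i m
    proof -
      have "0 = \<sigma> i v m - \<sigma> (Suc i) v m"
        using \<sigma>[OF piv _ v m, of i] \<sigma>[OF piv _ v m, of "Suc i"] i by auto
      also have "\<dots> = (\<Sum>r = 1..n - 1. if r = i then v (Suc i) m + v i m else 0)"
        unfolding \<sigma>_def sum_subtractf[symmetric] by (rule sum.cong) auto
      also have "\<dots> = v (Suc i) m + v i m" using i by (subst sum.delta) auto
      finally show ?thesis by (simp add: eq_neg_iff_add_eq_0)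
    qed
    \<comment> \<open>Three rows give \<open>3 * k\<close> unknowns, more than the at most
      \<open>k + 1\<close> equations as \<open>k\<close> is positive. The resulting \<open>v\<close>
      has zero row 4, and alternation carries this back to rows 3, 2 and 1.\<close>
    let ?J = "{1..3::nat} \<times> {1..k}"
    have "card T < card ?J" using T(2) k by (simp add: card_cartesian_product)
    then obtain y where y: "\<exists>p\<in>?J. y p \<noteq> 0"
      and y0: "\<And>t. t \<in> T \<Longrightarrow> (\<Sum>p\<in>?J. y p * f t (unit_mat (fst p) (snd p))) = 0"
      using underdetermined_system[of T ?J "\<lambda>t p. f t (unit_mat (fst p) (snd p))"] T(1) by auto
    define v where "v = (\<Sum>p\<in>?J. mscale (y p) (unit_mat (fst p) (snd p)))"
    have v_apply: "v r c = (if (r, c) \<in> ?J then y (r, c) else 0)" for r c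
    proof -
      have "v r c = (\<Sum>p\<in>?J. if p = (r, c) then y (r, c) else 0)"
        unfolding v_def sum_apply2 by (rule sum.cong) (auto simp: mscale_def unit_mat_def)
      then show ?thesis by simp
    qed
    have "v \<in> V0"
      unfolding V0_def solutions_def
    proof (intro CollectI conjI ballI allI)
      show "v \<in> mat_space n (Suc k)" using n k by (auto simp: mat_space_def v_apply)
      show "f t v = 0" if "t \<in> T" for t
        using y0[OF that] lin[OF that] by (simp add: v_def mat_functional_sum mat_functional_scale)
      show "v r (Suc k) = 0" for r by (simp add: v_apply)
    qed
    note st = step[OF this]
    have "v r m = 0" if "m \<in> {1..k}" "r \<in> {1..3}" for r m
    proof -
      have "v 4 m = - v 3 m" "v 3 m = - v 2 m" "v 2 m = - v 1 m"
        using st[of 3 m] st[of 2 m] st[of 1 m] that n k by (auto simp: eval_nat_numeral)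
      moreover have "v 4 m = 0" by (simp add: v_apply)
      moreover have "r = 1 \<or> r = 2 \<or> r = 3" using that(2) by auto
      ultimately show ?thesis by auto
    qed
    then have "y p = 0" if "p \<in> ?J" for p
      using that v_apply[of "fst p" "snd p"] by (metis mem_Sigma_iff prod.collapse)
    then show False using y by blast
  qed
qed

section \<open>Column operations and functionals for all columns\<close>

text \<open>A linear bijection \<open>g\<close> of the matrix space that preserves zeros of the form
  carries the system to one for the image; the new equations are the old ones composed with the
  inverse \<open>h\<close>.\<close>

lemma vanishing_system_transform:
  fixes f :: "'t \<Rightarrow> (nat \<Rightarrow> nat \<Rightarrow> 'a::field) \<Rightarrow> 'a"
  assumes sys: "vanishing_system n k T f b"
    and h: "\<And>X Y. h (X + Y) = h X + h Y" "\<And>c X. h (mscale c X) = mscale c (h X)"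
    and M: "\<forall>X\<in>mat_space n k. g X \<in> mat_space n k" "\<forall>X\<in>mat_space n k. h X \<in> mat_space n k"
    and inv: "\<And>X. h (g X) = X" "\<And>X. g (h X) = X"
    and g: "\<forall>X. maximal_minor_sum n k X = 0 \<longrightarrow> maximal_minor_sum n k (g X) = 0"
  shows "vanishing_system n k T (\<lambda>t X. f t (h X)) b"
    and "\<And>X. X \<in> solutions n k T f b \<Longrightarrow> g X \<in> solutions n k T (\<lambda>t X. f t (h X)) b"
proof -
  show img: "g X \<in> solutions n k T (\<lambda>t X. f t (h X)) b" if "X \<in> solutions n k T f b" for X
    using that M inv by (simp add: solutions_def)
  have "maximal_minor_sum n k Y = 0" if "Y \<in> solutions n k T (\<lambda>t X. f t (h X)) b" for Y
  proof -
    have "h Y \<in> solutions n k T f b" using that M by (simp add: solutions_def)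
    then have "maximal_minor_sum n k (g (h Y)) = 0" using sys g by (auto simp: vanishing_system_def)
    then show ?thesis by (simp add: inv)
  qed
  moreover have "solutions n k T (\<lambda>t X. f t (h X)) b \<noteq> {}"
    using sys img by (auto simp: vanishing_system_def)
  moreover have "mat_functional (\<lambda>X. f t (h X))" if "t \<in> T" for t
    using sys that by (auto simp: vanishing_system_def mat_functional_def h)
  ultimately show "vanishing_system n k T (\<lambda>t X. f t (h X)) b"
    using sys by (simp add: vanishing_system_def)
qed

definition swap_columns :: "nat \<Rightarrow> nat \<Rightarrow> (nat \<Rightarrow> nat \<Rightarrow> 'a) \<Rightarrow> nat \<Rightarrow> nat \<Rightarrow> 'a" where
  "swap_columns j m X = (\<lambda>r c. X r (if c = j then m else if c = m then j else c))"

definition add_column :: "nat \<Rightarrow> nat \<Rightarrow> 'a \<Rightarrow> (nat \<Rightarrow> nat \<Rightarrow> 'a::field) \<Rightarrow> nat \<Rightarrow> nat \<Rightarrow> 'a" where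
  "add_column j m s X = (\<lambda>r c. if c = j then X r c + s * X r m else X r c)"

lemma maximal_minor_sum_swap_columns:
  fixes X :: "nat \<Rightarrow> nat \<Rightarrow> 'a::field"
  assumes "j \<in> {1..k}" "m \<in> {1..k}" "maximal_minor_sum n k X = 0"
  shows "maximal_minor_sum n k (swap_columns j m X) = 0"
proof -
  let ?g = "\<lambda>l c. if l = (if c = j then m else if c = m then j else c) then 1 else (0 :: 'a)"
  have "maximal_minor_sum n k (swap_columns j m X) = maximal_minor_sum n k (\<lambda>i c. \<Sum>l\<in>{1..k}. X i l * ?g l c)"
  proof (rule maximal_minor_sum_cong)
    fix i c assume "c \<in> {1..k}"
    let ?c = "if c = j then m else if c = m then j else c"
    have "(\<Sum>l\<in>{1..k}. X i l * ?g l c) = (\<Sum>l\<in>{1..k}. if l = ?c then X i l else 0)"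
      by (rule sum.cong) auto
    also have "\<dots> = X i ?c"
      using assms \<open>c \<in> {1..k}\<close> by (subst sum.delta) auto
    finally show "swap_columns j m X i c = (\<Sum>l\<in>{1..k}. X i l * ?g l c)"
      by (simp add: swap_columns_def)
  qed
  then show ?thesis using assms(3) by (simp only: maximal_minor_sum_mult mult_zero_left)
qed

lemma maximal_minor_sum_add_column:
  fixes X :: "nat \<Rightarrow> nat \<Rightarrow> 'a::field"
  assumes "j \<in> {1..k}" "m \<in> {1..k}" "j \<noteq> m" "maximal_minor_sum n k X = 0"
  shows "maximal_minor_sum n k (add_column j m s X) = 0"
proof -
  let ?g = "\<lambda>l c. (if l = c then 1 else 0) + (if c = j \<and> l = m then s else (0 :: 'a))"
  have "maximal_minor_sum n k (add_column j m s X) = maximal_minor_sum n k (\<lambda>i c. \<Sum>l\<in>{1..k}. X i l * ?g l c)"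
  proof (rule maximal_minor_sum_cong)
    fix i c assume c: "c \<in> {1..k}"
    have "(\<Sum>l\<in>{1..k}. X i l * ?g l c) =
        (\<Sum>l\<in>{1..k}. if l = c then X i l else 0) + (\<Sum>l\<in>{1..k}. if l = m then (if c = j then X i l * s else 0) else 0)"
      unfolding sum.distrib[symmetric] by (rule sum.cong) (auto simp: algebra_simps)
    also have "\<dots> = X i c + (if c = j then X i m * s else 0)"
      using assms c by simp
    finally show "add_column j m s X i c = (\<Sum>l\<in>{1..k}. X i l * ?g l c)"
      by (simp add: add_column_def mult.commute)
  qed
  then show ?thesis using assms(4) by (simp only: maximal_minor_sum_mult mult_zero_left)
qed

text \<open>Exchanging column \<open>j\<close> with the last one reduces this to
  \<open>last_column_functional\<close>.\<close>

lemma column_functional: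
  fixes f :: "'t \<Rightarrow> (nat \<Rightarrow> nat \<Rightarrow> 'a::field) \<Rightarrow> 'a"
  assumes IH: "\<forall>n (T :: 't set) (f :: 't \<Rightarrow> (nat \<Rightarrow> nat \<Rightarrow> 'a) \<Rightarrow> 'a) b. vanishing_system n k T f b \<longrightarrow>
      odd k \<and> solutions n k T f b = zero_sum_mats n k"
    and sys: "vanishing_system n (Suc k) T f b" and j: "j \<in> {1..Suc k}"
  shows "\<exists>a \<beta>. (\<exists>r\<in>{1..n}. a r \<noteq> 0) \<and>
    (\<forall>X\<in>solutions n (Suc k) T f b. (\<Sum>r = 1..n. a r * X r j) = \<beta>)"
proof -
  let ?g = "swap_columns j (Suc k) :: (nat \<Rightarrow> nat \<Rightarrow> 'a) \<Rightarrow> _"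
  have add: "?g (X + Y) = ?g X + ?g Y" and scale: "?g (mscale c X) = mscale c (?g X)"
    and inv: "?g (?g X) = X" for X Y c
    by (auto simp: swap_columns_def mscale_def fun_eq_iff)
  have M: "\<forall>X\<in>mat_space n (Suc k). ?g X \<in> mat_space n (Suc k)"
    using j by (auto simp: swap_columns_def mat_space_def)
  have z: "\<forall>X. maximal_minor_sum n (Suc k) X = 0 \<longrightarrow> maximal_minor_sum n (Suc k) (?g X) = 0"
    by (intro allI impI maximal_minor_sum_swap_columns[OF j]) auto
  note tr = vanishing_system_transform[OF sys add scale M M inv inv z]
  obtain a \<beta> where a: "\<exists>r\<in>{1..n}. a r \<noteq> 0" and
    \<beta>: "\<forall>X\<in>solutions n (Suc k) T (\<lambda>t X. f t (?g X)) b. (\<Sum>r = 1..n. a r * X r (Suc k)) = \<beta>"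
    using last_column_functional[OF IH tr(1)] by blast
  have "?g X r (Suc k) = X r j" for X r by (simp add: swap_columns_def)
  then have "(\<Sum>r = 1..n. a r * X r j) = \<beta>" if "X \<in> solutions n (Suc k) T f b" for X
    using \<beta>[rule_format, OF tr(2)[OF that]] by simp
  then show ?thesis using a by blast
qed

text \<open>Adding column \<open>m\<close> to column \<open>j\<close> is invertible and preserves
  the form, so \<open>column_functional\<close> applies to the transformed system.\<close>

lemma column_sum_functional:
  fixes f :: "'t \<Rightarrow> (nat \<Rightarrow> nat \<Rightarrow> 'a::field) \<Rightarrow> 'a"
  assumes IH: "\<forall>n (T :: 't set) (f :: 't \<Rightarrow> (nat \<Rightarrow> nat \<Rightarrow> 'a) \<Rightarrow> 'a) b. vanishing_system n k T f b \<longrightarrow>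
      odd k \<and> solutions n k T f b = zero_sum_mats n k"
    and sys: "vanishing_system n (Suc k) T f b"
    and j: "j \<in> {1..Suc k}" and m: "m \<in> {1..Suc k}" and "j \<noteq> m"
  shows "\<exists>a \<beta>. (\<exists>r\<in>{1..n}. a r \<noteq> 0) \<and>
    (\<forall>X\<in>solutions n (Suc k) T f b. (\<Sum>r = 1..n. a r * (X r j + X r m)) = \<beta>)"
proof -
  let ?g = "add_column j m :: 'a \<Rightarrow> _"
  have add: "?g s (X + Y) = ?g s X + ?g s Y" and scale: "?g s (mscale c X) = mscale c (?g s X)"
    and inv: "?g (- s) (?g s X) = X" "?g s (?g (- s) X) = X" for X Y c s
    using \<open>j \<noteq> m\<close> by (auto simp: add_column_def mscale_def fun_eq_iff algebra_simps)
  have M: "\<forall>X\<in>mat_space n (Suc k). ?g s X \<in> mat_space n (Suc k)" for s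
    using j m by (auto simp: add_column_def mat_space_def)
  have z: "\<forall>X. maximal_minor_sum n (Suc k) X = 0 \<longrightarrow> maximal_minor_sum n (Suc k) (?g 1 X) = 0"
    using maximal_minor_sum_add_column[OF j m \<open>j \<noteq> m\<close>] by blast
  note tr = vanishing_system_transform[OF sys add scale M M inv z]
  obtain a \<beta> where a: "\<exists>r\<in>{1..n}. a r \<noteq> 0" and
    \<beta>: "\<forall>X\<in>solutions n (Suc k) T (\<lambda>t X. f t (?g (- 1) X)) b. (\<Sum>r = 1..n. a r * X r j) = \<beta>"
    using column_functional[OF IH tr(1) j] by blast
  have "?g 1 X r j = X r j + X r m" for X r by (simp add: add_column_def)
  then have "(\<Sum>r = 1..n. a r * (X r j + X r m)) = \<beta>" if "X \<in> solutions n (Suc k) T f b" for X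
    using \<beta>[rule_format, OF tr(2)[OF that]] by simp
  then show ?thesis using a by blast
qed

section \<open>A common functional for all columns and the induction step\<close>

lemma proportional_if_kernel_subset:
  fixes a a' :: "nat \<Rightarrow> 'a::field"
  assumes "\<exists>r\<in>{1..n}. a r \<noteq> 0" "\<exists>r\<in>{1..n}. a' r \<noteq> 0"
    and ker: "\<And>x. (\<Sum>r = 1..n. a r * x r) = 0 \<Longrightarrow> (\<Sum>r = 1..n. a' r * x r) = 0"
  shows "\<exists>\<mu>. \<mu> \<noteq> 0 \<and> (\<forall>r\<in>{1..n}. a' r = \<mu> * a r)"
proof -
  obtain q where q: "q \<in> {1..n}" "a q \<noteq> 0" using assms(1) by blast
  have val: "(\<Sum>r = 1..n. c r * (if r = p then s else if r = q then t else 0)) = c p * s + c q * t"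
    if "p \<in> {1..n}" "p \<noteq> q" for c :: "nat \<Rightarrow> 'a" and p s t
  proof -
    have "(\<Sum>r = 1..n. c r * (if r = p then s else if r = q then t else 0)) =
        (\<Sum>r = 1..n. (if r = p then c p * s else 0) + (if r = q then c q * t else 0))"
      by (rule sum.cong) (use that in auto)
    then show ?thesis using that q by (simp add: sum.distrib)
  qed
  have eq: "a' r = a' q / a q * a r" if r: "r \<in> {1..n}" for r
  proof (cases "r = q")
    case False
    \<comment> \<open>The test vector with entries \<open>a q\<close> at \<open>r\<close> and
      \<open>- a r\<close> at \<open>q\<close> lies in the kernel of \<open>a\<close>.\<close>
    have "(\<Sum>p = 1..n. a' p * (if p = r then a q else if p = q then - a r else 0)) = 0"
      by (rule ker) (simp only: val[OF r False], simp)
    then have "a' r * a q = a' q * a r" by (simp only: val[OF r False]) simp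
    then show ?thesis using q by (simp add: field_simps)
  qed (use q in simp)
  moreover have "a' q / a q \<noteq> 0" using eq assms(2) by force
  ultimately show ?thesis by blast
qed

text \<open>Cancelling adjacent rows makes \<open>a\<close> constant; a square block with one
  adjusted row then gives \<open>c = 0\<close>, and \<open>maximal_minor_sum_even_nonzero\<close>
  excludes even \<open>k\<close>.\<close>

lemma vanishing_hyperplane_product:
  fixes a c :: "nat \<Rightarrow> 'a::field"
  assumes n: "k + 2 \<le> n" and a: "\<exists>r\<in>{1..n}. a r \<noteq> 0"
    and vanish: "\<forall>X\<in>mat_space n k. (\<forall>j\<in>{1..k}. (\<Sum>r = 1..n. a r * X r j) = c j) \<longrightarrow>
        maximal_minor_sum n k X = 0"
  shows "odd k" and "\<exists>\<alpha>. \<alpha> \<noteq> 0 \<and> (\<forall>r\<in>{1..n}. a r = \<alpha>)" and "\<And>j. j \<in> {1..k} \<Longrightarrow> c j = 0"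
proof -
  \<comment> \<open>Opposite adjacent rows \<open>y, - y\<close> do not influence the form, but if \<open>a i \<noteq> a (Suc i)\<close> a suitable
    \<open>y\<close> compensates for an arbitrary choice of the other rows.\<close>
  have adj: "a i = a (Suc i)" if i: "i \<in> {1..<n}" for i
  proof (rule ccontr)
    assume ne: "a i \<noteq> a (Suc i)"
    \<comment> \<open>\<open>W\<close> spreads an identity block around the rows \<open>i\<close>
      and \<open>Suc i\<close>, so that deleting these two rows leaves the padded identity;
      \<open>n - 2\<close> rows suffice for it.\<close>
    define W :: "nat \<Rightarrow> nat \<Rightarrow> 'a" where
      "W r j = (if j \<in> {1..k} \<and> (r < i \<and> r = j \<or> Suc i < r \<and> r = j + 2) then 1 else 0)" for r j
    define y where "y j = (if j \<in> {1..k} then (c j - (\<Sum>r = 1..n. a r * W r j)) / (a i - a (Suc i)) else 0)" for j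
    define X where "X r j = W r j + (if r = i then y j else 0) + (if r = Suc i then - y j else 0)" for r j
    have "X \<in> mat_space n k"
      using i n by (auto simp: mat_space_def X_def W_def y_def)
    moreover have "(\<Sum>r = 1..n. a r * X r j) = c j" if j: "j \<in> {1..k}" for j
    proof -
      have "(\<Sum>r = 1..n. a r * X r j) = (\<Sum>r = 1..n. a r * W r j + (if r = i then a i * y j else 0)
          + (if r = Suc i then - a (Suc i) * y j else 0))"
        by (rule sum.cong) (auto simp: X_def algebra_simps)
      also have "\<dots> = (\<Sum>r = 1..n. a r * W r j) + (a i - a (Suc i)) * y j"
        using i by (simp add: sum.distrib algebra_simps)
      also have "\<dots> = c j" using ne j by (simp add: y_def)
      finally show ?thesis .
    qed
    ultimately have "0 = maximal_minor_sum n k X" using vanish by simp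
    also have "\<dots> = maximal_minor_sum (n - 2) k (\<lambda>r. if r < i then X r else X (r + 2))"
      by (rule maximal_minor_sum_cancel[OF i]) (auto simp: X_def W_def)
    also have "\<dots> = maximal_minor_sum (n - 2) k (\<lambda>r j. if r = j then 1 else 0)"
      by (rule maximal_minor_sum_cong) (auto simp: X_def W_def)
    also have "\<dots> = 1" by (rule maximal_minor_sum_identity) (use n in auto)
    finally show False by simp
  qed
  define \<alpha> where "\<alpha> = a 1"
  have const: "a r = \<alpha>" if "r \<in> {1..n}" for r
    using that
  proof (induction r)
    case (Suc r)
    then show ?case using adj[of r] by (cases "r = 0") (auto simp: \<alpha>_def)
  qed simp
  then have \<alpha>: "\<alpha> \<noteq> 0" using a by force
  then show "\<exists>\<alpha>. \<alpha> \<noteq> 0 \<and> (\<forall>r\<in>{1..n}. a r = \<alpha>)" using const by blast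
  have sum_a: "(\<Sum>r = 1..n. a r * X r j) = \<alpha> * (\<Sum>r = 1..n. X r j)" for X :: "nat \<Rightarrow> nat \<Rightarrow> 'a" and j
    unfolding sum_distrib_left by (rule sum.cong) (use const in auto)
  show c: "c j = 0" if j: "j \<in> {1..k}" for j
  proof (rule ccontr)
    assume ne: "c j \<noteq> 0"
    \<comment> \<open>Row \<open>j\<close> of the identity is replaced by the vector that gives
      every column the required sum; its \<open>j\<close>-th entry, hence the determinant, is
      \<open>c j / \<alpha>\<close>.\<close>
    define y where "y m = c m / \<alpha> - (if m = j then 0 else 1)" for m
    define X where "X r m = (if r \<in> {1..k} \<and> m \<in> {1..k} then
        if r = j then y m else if r = m then 1 else 0 else 0)" for r m
    have "X \<in> mat_space n k" using n by (auto simp: X_def mat_space_def)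
    moreover have "(\<Sum>r = 1..n. a r * X r m) = c m" if m: "m \<in> {1..k}" for m
    proof -
      have "(\<Sum>r = 1..n. X r m) = (\<Sum>r = 1..n. (if r = j then y m else 0) + (if r = m then (if m = j then 0 else 1) else 0))"
        by (rule sum.cong) (use m j in \<open>auto simp: X_def\<close>)
      also have "\<dots> = c m / \<alpha>" using m j n by (simp add: sum.distrib y_def)
      finally show ?thesis unfolding sum_a using \<alpha> by simp
    qed
    ultimately have "0 = maximal_minor_sum n k X" using vanish by simp
    also have "\<dots> = det_k k X"
      by (rule maximal_minor_sum_eq_det_k) (use n in \<open>auto simp: X_def\<close>)
    also have "\<dots> = det_k k (\<lambda>r m. if r = j then y m else if r = m then 1 else 0)"
      by (rule det_k_cong) (auto simp: X_def)
    also have "\<dots> = c j / \<alpha>"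
      by (subst det_k_identity_replace_row[OF j]) (simp add: y_def)
    finally show False using ne \<alpha> by simp
  qed
  show "odd k"
  proof (rule ccontr)
    assume "\<not> odd k"
    then obtain X :: "nat \<Rightarrow> nat \<Rightarrow> 'a" where "X \<in> mat_space n k"
      "\<And>j. j \<in> {1..k} \<Longrightarrow> (\<Sum>i = 1..n. X i j) = 0" "maximal_minor_sum n k X \<noteq> 0"
      using maximal_minor_sum_even_nonzero[of k n] n by auto
    then show False using vanish c unfolding sum_a by simp
  qed
qed

text \<open>The column functionals present the solutions as an affine product of hyperplanes. A
  functional of the sum of two columns must annihilate both column kernels, which makes the
  hyperplanes parallel and leads to \<open>vanishing_hyperplane_product\<close>.\<close>

lemma vanishing_system_step:
  fixes f :: "'t \<Rightarrow> (nat \<Rightarrow> nat \<Rightarrow> 'a::field) \<Rightarrow> 'a"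
  assumes IH: "\<forall>n (T :: 't set) (f :: 't \<Rightarrow> (nat \<Rightarrow> nat \<Rightarrow> 'a) \<Rightarrow> 'a) b. vanishing_system n k T f b \<longrightarrow>
      odd k \<and> solutions n k T f b = zero_sum_mats n k"
    and sys: "vanishing_system n (Suc k) T f b"
  shows "odd (Suc k) \<and> solutions n (Suc k) T f b = zero_sum_mats n (Suc k)"
proof -
  let ?K = "solutions n (Suc k) T f b" and ?V = "solutions n (Suc k) T f (\<lambda>_. 0)"
  have n: "Suc k + 2 \<le> n" and T: "finite T" "card T \<le> Suc k"
    and lin: "\<And>t. t \<in> T \<Longrightarrow> mat_functional (f t)"
    and vanish: "\<And>X. X \<in> ?K \<Longrightarrow> maximal_minor_sum n (Suc k) X = 0"
    using sys by (auto simp: vanishing_system_def)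
  obtain X0 where X0: "X0 \<in> ?K" using sys by (auto simp: vanishing_system_def)
  have "\<forall>j\<in>{1..Suc k}. \<exists>a. (\<exists>r\<in>{1..n}. a r \<noteq> 0) \<and>
      (\<forall>X\<in>?K. (\<Sum>r = 1..n. a r * X r j) = (\<Sum>r = 1..n. a r * X0 r j))"
  proof
    fix j assume "j \<in> {1..Suc k}"
    from column_functional[OF IH sys this] obtain a \<beta> where "\<exists>r\<in>{1..n}. a r \<noteq> 0"
      and "\<forall>X\<in>?K. (\<Sum>r = 1..n. a r * X r j) = \<beta>" by blast
    with X0 show "\<exists>a. (\<exists>r\<in>{1..n}. a r \<noteq> 0) \<and>
        (\<forall>X\<in>?K. (\<Sum>r = 1..n. a r * X r j) = (\<Sum>r = 1..n. a r * X0 r j))"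
      by (intro exI[of _ a]) simp
  qed
  then obtain A where "\<forall>j\<in>{1..Suc k}. (\<exists>r\<in>{1..n}. A j r \<noteq> 0) \<and>
      (\<forall>X\<in>?K. (\<Sum>r = 1..n. A j r * X r j) = (\<Sum>r = 1..n. A j r * X0 r j))"
    by (rule bchoice[THEN exE])
  then have A: "\<And>j. j \<in> {1..Suc k} \<Longrightarrow> \<exists>r\<in>{1..n}. A j r \<noteq> 0"
    and A_X0: "\<And>j X. j \<in> {1..Suc k} \<Longrightarrow> X \<in> ?K \<Longrightarrow>
      (\<Sum>r = 1..n. A j r * X r j) = (\<Sum>r = 1..n. A j r * X0 r j)" by blast+
  have V_A: "(\<Sum>r = 1..n. A j r * v r j) = 0" if v: "v \<in> ?V" and j: "j \<in> {1..Suc k}" for v j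
    using A_X0[OF j solutions_add[OF lin X0 v]] by (simp add: ring_distribs sum.distrib)
  have V: "X \<in> ?V" if "X \<in> mat_space n (Suc k)"
    and "\<And>j. j \<in> {1..Suc k} \<Longrightarrow> (\<Sum>r = 1..n. A j r * X r j) = 0" for X
    by (rule kernel_eq_product_of_kernels[of T "Suc k" f n A]) (use T lin A V_A that in blast)+
  \<comment> \<open>A matrix whose only nonzero column \<open>l\<close> lies in the kernel of
    \<open>A l\<close> may be added to \<open>X0\<close>, so a functional constant on sums of
    columns \<open>j\<close> and \<open>m\<close> kills that column.\<close>
  have ker: "(\<Sum>r = 1..n. a r * x r) = 0"
    if c: "\<And>X. X \<in> ?K \<Longrightarrow> (\<Sum>r = 1..n. a r * (X r j + X r m)) = \<gamma>"
      and l: "l \<in> {1..Suc k}" "l = j \<or> l = m" and "j \<noteq> m"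
      and x: "(\<Sum>r = 1..n. A l r * x r) = 0" for a x j m l \<gamma>
  proof -
    define X where "X r c = (if r \<in> {1..n} \<and> c = l then x r else 0)" for r c
    have X: "X \<in> ?V"
    proof (rule V)
      show "X \<in> mat_space n (Suc k)" using l(1) by (auto simp: X_def mat_space_def)
      show "(\<Sum>r = 1..n. A i r * X r i) = 0" if "i \<in> {1..Suc k}" for i
        using x by (cases "i = l") (simp_all add: X_def)
    qed
    have "(\<Sum>r = 1..n. a r * x r) = (\<Sum>r = 1..n. a r * (X r j + X r m))"
      by (rule sum.cong) (use l(2) \<open>j \<noteq> m\<close> in \<open>auto simp: X_def\<close>)
    moreover have "(\<Sum>r = 1..n. a r * ((X0 + X) r j + (X0 + X) r m)) =
        (\<Sum>r = 1..n. a r * (X0 r j + X0 r m)) + (\<Sum>r = 1..n. a r * (X r j + X r m))"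
      by (simp add: ring_distribs sum.distrib add_ac)
    then have "(\<Sum>r = 1..n. a r * (X r j + X r m)) = 0"
      using c[OF X0] c[OF solutions_add[OF lin X0 X]] by simp
    ultimately show ?thesis by simp
  qed
  have proportional: "\<exists>\<mu>. \<mu> \<noteq> 0 \<and> (\<forall>r\<in>{1..n}. A j r = \<mu> * A 1 r)" if j: "j \<in> {1..Suc k}" for j
  proof (cases "j = 1")
    case True
    then show ?thesis by (intro exI[of _ 1]) simp
  next
    case False
    have 1: "1 \<in> {1..Suc k}" by simp
    obtain a \<gamma> where a: "\<exists>r\<in>{1..n}. a r \<noteq> 0"
      and c: "\<And>X. X \<in> ?K \<Longrightarrow> (\<Sum>r = 1..n. a r * (X r j + X r 1)) = \<gamma>"
      using column_sum_functional[OF IH sys j 1 False] by blast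
    obtain \<mu> where \<mu>: "\<mu> \<noteq> 0" "\<forall>r\<in>{1..n}. a r = \<mu> * A j r"
      using proportional_if_kernel_subset[OF A[OF j] a ker[OF c j _ False]] by auto
    obtain \<nu> where \<nu>: "\<nu> \<noteq> 0" "\<forall>r\<in>{1..n}. a r = \<nu> * A 1 r"
      using proportional_if_kernel_subset[OF A[OF 1] a ker[OF c 1 _ False]] by auto
    have "A j r = \<nu> / \<mu> * A 1 r" if "r \<in> {1..n}" for r
      using \<mu> \<nu> that by (metis nonzero_mult_div_cancel_left times_divide_eq_left)
    then show ?thesis using \<mu>(1) \<nu>(1) by (intro exI[of _ "\<nu> / \<mu>"]) simp
  qed
  define a where "a = A 1"
  have a: "\<exists>r\<in>{1..n}. a r \<noteq> 0" unfolding a_def by (rule A) simp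
  have A_a: "(\<Sum>r = 1..n. A j r * x r) = 0 \<longleftrightarrow> (\<Sum>r = 1..n. a r * x r) = 0" if j: "j \<in> {1..Suc k}" for j x
  proof -
    obtain \<mu> where \<mu>: "\<mu> \<noteq> 0" "\<forall>r\<in>{1..n}. A j r = \<mu> * a r"
      using proportional[OF j] by (auto simp: a_def)
    have "(\<Sum>r = 1..n. A j r * x r) = \<mu> * (\<Sum>r = 1..n. a r * x r)"
      unfolding sum_distrib_left by (rule sum.cong) (use \<mu>(2) in \<open>auto simp: mult_ac\<close>)
    then show ?thesis using \<mu>(1) by simp
  qed
  define c where "c j = (\<Sum>r = 1..n. a r * X0 r j)" for j
  have K: "X \<in> ?K \<longleftrightarrow> X \<in> mat_space n (Suc k) \<and> (\<forall>j\<in>{1..Suc k}. (\<Sum>r = 1..n. a r * X r j) = c j)" for X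
  proof -
    have lc: "(\<Sum>r = 1..n. a r * (X - X0) r j) = (\<Sum>r = 1..n. a r * X r j) - c j" for j
      by (simp add: c_def right_diff_distrib sum_subtractf)
    show ?thesis
    proof
      assume X: "X \<in> ?K"
      then have "X - X0 \<in> ?V" by (intro solutions_diff[OF lin _ X0])
      then have "(\<Sum>r = 1..n. a r * (X - X0) r j) = 0" if "j \<in> {1..Suc k}" for j
        using V_A[of "X - X0" j] A_a[of j "\<lambda>r. (X - X0) r j"] that by blast
      then show "X \<in> mat_space n (Suc k) \<and> (\<forall>j\<in>{1..Suc k}. (\<Sum>r = 1..n. a r * X r j) = c j)"
        using X lc by (auto simp: solutions_def)
    next
      assume X: "X \<in> mat_space n (Suc k) \<and> (\<forall>j\<in>{1..Suc k}. (\<Sum>r = 1..n. a r * X r j) = c j)"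
      have "X - X0 \<in> ?V"
      proof (rule V)
        show "X - X0 \<in> mat_space n (Suc k)"
          using X X0 by (auto simp: solutions_def intro: mat_space_diff)
        show "(\<Sum>r = 1..n. A j r * (X - X0) r j) = 0" if "j \<in> {1..Suc k}" for j
          unfolding A_a[OF that, of "\<lambda>r. (X - X0) r j"] lc using X that by simp
      qed
      from solutions_add[OF lin X0 this] show "X \<in> ?K" by simp
    qed
  qed
  have van: "\<forall>X\<in>mat_space n (Suc k). (\<forall>j\<in>{1..Suc k}. (\<Sum>r = 1..n. a r * X r j) = c j) \<longrightarrow>
      maximal_minor_sum n (Suc k) X = 0"
    using vanish K by blast
  note hyp = vanishing_hyperplane_product[OF n a van]
  obtain \<alpha> where \<alpha>: "\<alpha> \<noteq> 0" "\<forall>r\<in>{1..n}. a r = \<alpha>" using hyp(2) by blast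
  have "(\<Sum>r = 1..n. a r * X r j) = \<alpha> * (\<Sum>r = 1..n. X r j)" for X :: "nat \<Rightarrow> nat \<Rightarrow> 'a" and j
    unfolding sum_distrib_left by (rule sum.cong) (use \<alpha>(2) in auto)
  then have "?K = zero_sum_mats n (Suc k)"
    using \<alpha>(1) hyp(3) unfolding zero_sum_mats_def set_eq_iff K by auto
  with hyp(1) show ?thesis by blast
qed

lemma vanishing_system_solutions:
  fixes f :: "'t \<Rightarrow> (nat \<Rightarrow> nat \<Rightarrow> 'a::field) \<Rightarrow> 'a"
  assumes "vanishing_system n k T f b"
  shows "odd k \<and> solutions n k T f b = zero_sum_mats n k"
proof -
  have "\<forall>n (T :: 't set) (f :: 't \<Rightarrow> (nat \<Rightarrow> nat \<Rightarrow> 'a) \<Rightarrow> 'a) b. vanishing_system n k T f b \<longrightarrow>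
      odd k \<and> solutions n k T f b = zero_sum_mats n k"
  proof (induction k)
    case 0
    \<comment> \<open>The only minor of size 0 is the empty determinant 1, so no vanishing system
      exists.\<close>
    have "maximal_minor_sum n 0 X = 1" for n and X :: "nat \<Rightarrow> nat \<Rightarrow> 'a"
      by (subst maximal_minor_sum_eq_det_k) (auto simp: det_k_def)
    then have "\<not> vanishing_system n 0 T f b" for n b and T :: "'t set" and f :: "'t \<Rightarrow> (nat \<Rightarrow> nat \<Rightarrow> 'a) \<Rightarrow> 'a"
      by (auto simp: vanishing_system_def)
    then show ?case by blast
  next
    case (Suc k)
    then show ?case using vanishing_system_step by blast
  qed
  with assms show ?thesis by blast
qed

section \<open>Linear varieties as solution sets\<close>

text \<open>A basis \<open>B\<close> of \<open>V\<close> is extended to a basis \<open>B'\<close> of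
  the matrix space; the coordinate functionals belonging to \<open>B' - B\<close> cut out
  \<open>V\<close>. The equations are indexed by these basis vectors themselves.\<close>

lemma subspace_eq_solutions:
  fixes V :: "(nat \<Rightarrow> nat \<Rightarrow> 'a::field) set"
  assumes V: "mat.subspace V" "V \<subseteq> mat_space n k"
  obtains T f where "finite T" "card T \<le> n * k - mat.dim V"
    "\<And>t :: nat \<Rightarrow> nat \<Rightarrow> 'a. t \<in> T \<Longrightarrow> mat_functional (f t)" "V = solutions n k T f (\<lambda>_. 0)"
proof -
  let ?M = "mat_space n k :: (nat \<Rightarrow> nat \<Rightarrow> 'a) set"
  let ?E = "(\<lambda>(i, j). unit_mat i j) ` ({1..n} \<times> {1..k}) :: (nat \<Rightarrow> nat \<Rightarrow> 'a) set"
  obtain B where B: "B \<subseteq> V" "mat.independent B" "V \<subseteq> mat.span B" "card B = mat.dim V"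
    by (rule mat.basis_exists)
  have spanB: "mat.span B = V"
    using B V by (simp add: mat.span_minimal subset_antisym)
  have "B \<subseteq> ?M" using B V by blast
  then obtain B' where B': "B \<subseteq> B'" "B' \<subseteq> ?M" "mat.independent B'" "?M \<subseteq> mat.span B'"
    using B(2) by (rule mat.maximal_independent_subset_extend)
  have M_E: "?M \<subseteq> mat.span ?E"
  proof
    fix X assume "X \<in> ?M"
    then have "X = (\<Sum>(i, j)\<in>{1..n} \<times> {1..k}. mscale (X i j) (unit_mat i j))" by (rule mat_space_eq_sum)
    also have "\<dots> \<in> mat.span ?E"
      unfolding split_def
      by (intro mat.span_sum mat.span_scale mat.span_base) force
    finally show "X \<in> mat.span ?E" .
  qed
  have "finite B' \<and> card B' \<le> card ?E"
    using B' M_E by (intro mat.independent_span_bound) auto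
  moreover have "card ?E \<le> n * k"
    using card_image_le[of "{1..n} \<times> {1..k}" "\<lambda>(i, j). unit_mat i j :: nat \<Rightarrow> nat \<Rightarrow> 'a"]
    by (simp add: card_cartesian_product)
  ultimately have fin: "finite B'" and card: "card B' \<le> n * k" by auto
  define T where "T = B' - B"
  have "\<forall>t. \<exists>\<phi>. mat_functional \<phi> \<and> (\<forall>v\<in>B'. \<phi> v = (if v = t then 1 else 0))"
  proof
    fix t
    obtain \<phi> where "mat_functional \<phi>" "\<And>v. v \<in> B' \<Longrightarrow> \<phi> v = (if v = t then 1 else 0)"
      by (rule mat_functional_extend[OF B'(3), where h = "\<lambda>v. if v = t then 1 else 0"]) blast
    then show "\<exists>\<phi>. mat_functional \<phi> \<and> (\<forall>v\<in>B'. \<phi> v = (if v = t then 1 else 0))" by blast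
  qed
  then obtain f where f: "\<And>t. mat_functional (f t)"
    and f_B': "\<And>t v. v \<in> B' \<Longrightarrow> f t v = (if v = t then 1 else 0)" by metis
  show thesis
  proof
    show "finite T" using fin by (simp add: T_def)
    have "card T = card B' - card B"
      unfolding T_def using B'(1) fin by (intro card_Diff_subset) (auto intro: finite_subset)
    then show "card T \<le> n * k - mat.dim V" using card B(4) by simp
    show "mat_functional (f t)" for t by (rule f)
    show "V = solutions n k T f (\<lambda>_. 0)"
    proof (intro equalityI subsetI)
      fix v assume v: "v \<in> V"
      have "f t v = 0" if "t \<in> T" for t
        by (rule mat_functional_eq_0_on_span[OF f, of B])
          (use v spanB that f_B' B'(1) in \<open>auto simp: T_def\<close>)
      then show "v \<in> solutions n k T f (\<lambda>_. 0)" using v V(2) by (auto simp: solutions_def)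
    next
      fix X assume X: "X \<in> solutions n k T f (\<lambda>_. 0)"
      then have "X \<in> mat.span B'" using B'(4) by (auto simp: solutions_def)
      then obtain u where u: "X = (\<Sum>v\<in>B'. mscale (u v) v)"
        using mat.span_finite[OF fin] by blast
      have "u t = 0" if t: "t \<in> T" for t
      proof -
        have "0 = f t X" using X t by (simp add: solutions_def)
        also have "\<dots> = (\<Sum>v\<in>B'. u v * f t v)"
          unfolding u by (simp add: mat_functional_sum[OF f] mat_functional_scale[OF f])
        also have "\<dots> = (\<Sum>v\<in>B'. if v = t then u t else 0)"
          by (rule sum.cong) (auto simp: f_B')
        also have "\<dots> = u t" using t fin by (simp add: T_def)
        finally show ?thesis by simp
      qed
      then have "(\<Sum>v\<in>B' - B. mscale (u v) v) = 0"
        by (intro sum.neutral) (simp add: T_def)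
      then have "X = (\<Sum>v\<in>B. mscale (u v) v)"
        unfolding u using sum.subset_diff[OF B'(1) fin, of "\<lambda>v. mscale (u v) v"] by simp
      also have "\<dots> \<in> mat.span B" by (intro mat.span_sum mat.span_scale mat.span_base)
      finally show "X \<in> V" by (simp add: spanB)
    qed
  qed
qed

text \<open>This involution exchanges alternating and plain row sums, and correspondingly the zeros
  of \<open>cullis_det\<close> and of \<open>maximal_minor_sum\<close>.\<close>

definition flip_rows :: "(nat \<Rightarrow> nat \<Rightarrow> 'a::comm_ring_1) \<Rightarrow> nat \<Rightarrow> nat \<Rightarrow> 'a" where
  "flip_rows X = (\<lambda>i j. (-1) ^ i * X i j)"

lemma flip_rows_flip_rows: "flip_rows (flip_rows X) = X"
  by (simp add: flip_rows_def mult.assoc[symmetric] power_mult_distrib[symmetric])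

lemma flip_rows_in_mat_space: "X \<in> mat_space n k \<Longrightarrow> flip_rows X \<in> mat_space n k"
  by (auto simp: flip_rows_def mat_space_def)

definition alternating_sum_mats :: "nat \<Rightarrow> nat \<Rightarrow> (nat \<Rightarrow> nat \<Rightarrow> 'a::comm_ring_1) set" where
  "alternating_sum_mats n k = {X \<in> mat_space n k. \<forall>j\<in>{1..k}. (\<Sum>i=1..n. (-1) ^ i * X i j) = 0}"

lemma variety_eq_alternating_sum_mats:
  fixes K :: "(nat \<Rightarrow> nat \<Rightarrow> 'a::field) set"
  assumes n: "k + 2 \<le> n" and s: "s \<in> mat_space n k" and V: "mat.subspace V" "V \<subseteq> mat_space n k"
    and K: "K = (\<lambda>v. s + v) ` V" and codim: "n * k - mat.dim V \<le> k"
    and vanish: "\<And>X. X \<in> K \<Longrightarrow> cullis_det n k X = 0"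
  shows "odd k \<and> K = alternating_sum_mats n k"
proof -
  obtain T and f :: "(nat \<Rightarrow> nat \<Rightarrow> 'a) \<Rightarrow> (nat \<Rightarrow> nat \<Rightarrow> 'a) \<Rightarrow> 'a" where T: "finite T" "card T \<le> n * k - mat.dim V"
    and f: "\<And>t. t \<in> T \<Longrightarrow> mat_functional (f t)" and Vf: "V = solutions n k T f (\<lambda>_. 0)"
    using subspace_eq_solutions[OF V] by metis
  have K_f: "X \<in> K \<longleftrightarrow> X \<in> mat_space n k \<and> (\<forall>t\<in>T. f t X = f t s)" for X
  proof -
    have "X \<in> K \<longleftrightarrow> X - s \<in> V"
    proof
      assume "X - s \<in> V"
      then show "X \<in> K" unfolding K by (rule rev_image_eqI) simp
    qed (auto simp: K)
    also have "\<dots> \<longleftrightarrow> X - s \<in> mat_space n k \<and> (\<forall>t\<in>T. f t X = f t s)"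
      using f by (auto simp: Vf solutions_def mat_functional_diff)
    also have "X - s \<in> mat_space n k \<longleftrightarrow> X \<in> mat_space n k"
      using s mat_space_add[of "X - s" n k s] mat_space_diff[of X n k s] by auto
    finally show ?thesis .
  qed
  \<comment> \<open>The system describes the flipped matrices of \<open>K\<close>, where Cullis'
    determinant becomes the unsigned form.\<close>
  let ?f = "\<lambda>t X. f t (flip_rows X)" and ?b = "\<lambda>t. f t s"
  have sol: "X \<in> solutions n k T ?f ?b \<longleftrightarrow> flip_rows X \<in> K" for X
    using flip_rows_in_mat_space[of X n k] flip_rows_in_mat_space[of "flip_rows X" n k]
    by (auto simp: solutions_def K_f flip_rows_flip_rows)
  have "vanishing_system n k T ?f ?b"
    unfolding vanishing_system_def
  proof (intro conjI ballI)
    show "card T \<le> k" using T codim by simp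
    have "s \<in> K" using s by (simp add: K_f)
    then have "flip_rows s \<in> solutions n k T ?f ?b" by (simp add: sol flip_rows_flip_rows)
    then show "solutions n k T ?f ?b \<noteq> {}" by blast
    show "mat_functional (?f t)" if "t \<in> T" for t
    proof -
      have "flip_rows (X + Y) = flip_rows X + flip_rows Y" "flip_rows (mscale c X) = mscale c (flip_rows X)"
        for X Y :: "nat \<Rightarrow> nat \<Rightarrow> 'a" and c
        by (auto simp: flip_rows_def mscale_def fun_eq_iff algebra_simps)
      then show ?thesis using f[OF that] by (simp add: mat_functional_def)
    qed
    show "maximal_minor_sum n k X = 0" if "X \<in> solutions n k T ?f ?b" for X
    proof -
      have "cullis_det n k (flip_rows X) = 0" using vanish that sol by blast
      then have "maximal_minor_sum n k (flip_rows (flip_rows X)) = 0"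
        by (simp only: cullis_det_eq_0_iff flip_rows_def)
      then show ?thesis by (simp only: flip_rows_flip_rows)
    qed
  qed (use n T in auto)
  from vanishing_system_solutions[OF this]
  have "odd k" and sol_eq: "solutions n k T ?f ?b = zero_sum_mats n k" by auto
  have "X \<in> K \<longleftrightarrow> X \<in> alternating_sum_mats n k" for X
  proof -
    have "X \<in> K \<longleftrightarrow> flip_rows X \<in> zero_sum_mats n k"
      using sol[of "flip_rows X"] by (simp add: sol_eq flip_rows_flip_rows)
    also have "\<dots> \<longleftrightarrow> X \<in> alternating_sum_mats n k"
      using flip_rows_in_mat_space[of X n k] flip_rows_in_mat_space[of "flip_rows X" n k]
      by (auto simp: zero_sum_mats_def alternating_sum_mats_def flip_rows_flip_rows)
        (auto simp: flip_rows_def)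
    finally show ?thesis .
  qed
  with \<open>odd k\<close> show ?thesis by blast
qed

section \<open>The dimension of the exceptional space and the equivalence\<close>

text \<open>The first \<open>n - 1\<close> rows can be chosen freely and determine the last one, so
  there is one basis element \<open>u (i, j)\<close> for each entry outside row
  \<open>n\<close>.\<close>

lemma dim_alternating_sum_mats:
  assumes "0 < n"
  shows "mat.dim (alternating_sum_mats n k :: (nat \<Rightarrow> nat \<Rightarrow> 'a::field) set) = (n - 1) * k"
proof -
  let ?I = "{1..n - 1} \<times> {1..k}"
  \<comment> \<open>The entry \<open>- ((-1) ^ (i + n))\<close> in row \<open>n\<close> compensates
    for the entry 1 in row \<open>i\<close> of the alternating sum.\<close>
  define u :: "nat \<times> nat \<Rightarrow> nat \<Rightarrow> nat \<Rightarrow> 'a" where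
    "u p = unit_mat (fst p) (snd p) - mscale ((-1) ^ (fst p + n)) (unit_mat n (snd p))" for p
  have u_val: "u p i j = (if p = (i, j) then 1 else 0)" if "i < n" for p i j
    using that by (auto simp: u_def unit_mat_def mscale_def prod_eq_iff)
  have u_n: "u p n j = (if snd p = j then - ((-1) ^ (fst p + n)) else 0)" if "p \<in> ?I" for p j
    using that assms by (auto simp: u_def unit_mat_def mscale_def)
  have lt: "i < n" if "(i, j) \<in> ?I" for i j using that assms by auto
  have inj: "inj_on u ?I"
  proof (rule inj_onI)
    fix p q assume p: "p \<in> ?I" and eq: "u p = u q"
    have "u p (fst p) (snd p) = 1" using p lt[of "fst p" "snd p"] by (simp add: u_val)
    then have "u q (fst p) (snd p) = 1" by (simp add: eq)
    then show "p = q" using p lt[of "fst p" "snd p"] by (auto simp: u_val split: if_splits)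
  qed
  have coeff: "(\<Sum>p\<in>?I. mscale (c p) (u p)) i j = c (i, j)" if "(i, j) \<in> ?I" for c i j
  proof -
    have "(\<Sum>p\<in>?I. mscale (c p) (u p)) i j = (\<Sum>p\<in>?I. if p = (i, j) then c (i, j) else 0)"
      unfolding sum_apply2 by (rule sum.cong) (auto simp: mscale_def u_val[OF lt[OF that]])
    then show ?thesis using that by (simp only: sum.delta finite_SigmaI finite_atLeastAtMost) simp
  qed
  show ?thesis
  proof (rule mat.dim_unique)
    show "card (u ` ?I) = (n - 1) * k" 
      unfolding card_image[OF inj] by (simp add: card_cartesian_product)
    show "mat.independent (u ` ?I)"
    proof (rule mat.independent_if_scalars_zero)
      fix c x assume 0: "(\<Sum>x\<in>u ` ?I. mscale (c x) x) = 0" and "x \<in> u ` ?I"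
      then obtain i j where p: "(i, j) \<in> ?I" "x = u (i, j)" by auto
      have "(\<Sum>p\<in>?I. mscale (c (u p)) (u p)) = 0"
        using 0 unfolding sum.reindex[OF inj] by (simp add: o_def)
      then have "(\<Sum>p\<in>?I. mscale (c (u p)) (u p)) i j = 0" by simp
      then show "c x = 0" using coeff[OF p(1), of "\<lambda>p. c (u p)"] p(2) by simp
    qed simp
    show "u ` ?I \<subseteq> alternating_sum_mats n k"
    proof
      fix x assume "x \<in> u ` ?I"
      then obtain i j where p: "(i, j) \<in> ?I" "x = u (i, j)" by auto
      have "u (i, j) \<in> mat_space n k"
        unfolding u_def using p(1) assms
        by (intro mat_space_diff mat_space_scale unit_mat_in_mat_space) auto
      moreover have "(\<Sum>r = 1..n. (-1) ^ r * u (i, j) r m) = 0" if "m \<in> {1..k}" for m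
      proof -
        have "(\<Sum>r = 1..n. (-1) ^ r * u (i, j) r m) =
            (\<Sum>r = 1..n. (if r = i then (if j = m then (-1) ^ i else 0) else 0)
              - (if r = n then (if j = m then (-1) ^ n * (-1) ^ (i + n) else 0) else 0))"
          using p(1) by (intro sum.cong) (auto simp: u_def unit_mat_def mscale_def)
        also have "\<dots> = 0"
          using p(1) lt[OF p(1)] by (simp add: sum_subtractf power_add mult.assoc[symmetric] power_mult_distrib[symmetric])
        finally show ?thesis .
      qed
      ultimately show "x \<in> alternating_sum_mats n k" by (simp add: alternating_sum_mats_def p(2))
    qed
    show "alternating_sum_mats n k \<subseteq> mat.span (u ` ?I)"
    proof
      fix X :: "nat \<Rightarrow> nat \<Rightarrow> 'a" assume X: "X \<in> alternating_sum_mats n k"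
      let ?Y = "\<Sum>p\<in>?I. mscale (X (fst p) (snd p)) (u p)"
      have "X i j = ?Y i j" for i j
      proof (cases "(i, j) \<in> ?I")
        case True
        then show ?thesis using coeff[of i j "\<lambda>p. X (fst p) (snd p)"] by simp
      next
        case False
        show ?thesis
        proof (cases "i = n \<and> j \<in> {1..k}")
          case True
          have "?Y n j = (\<Sum>p\<in>?I. X (fst p) (snd p) * u p n j)"
            by (simp add: sum_apply2 mscale_def)
          also have "\<dots> = (\<Sum>i = 1..n - 1. \<Sum>m = 1..k. if m = j then X i j * - ((-1) ^ (i + n)) else 0)"
            unfolding sum.cartesian_product by (rule sum.cong) (auto simp: u_n)
          also have "\<dots> = (\<Sum>i = 1..n - 1. X i j * - ((-1) ^ (i + n)))"
            using True by simp
          also have "\<dots> = - ((-1) ^ n) * (\<Sum>i = 1..n - 1. (-1) ^ i * X i j)"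
            by (simp add: sum_distrib_left power_add mult_ac sum_negf)
          also have "(\<Sum>i = 1..n - 1. (-1) ^ i * X i j) = - ((-1) ^ n * X n j)"
          proof -
            have "0 = (\<Sum>i = 1..n. (-1) ^ i * X i j)"
              using X True by (simp add: alternating_sum_mats_def)
            also have "\<dots> = (\<Sum>i = 1..n - 1. (-1) ^ i * X i j) + (-1) ^ n * X n j"
              using assms by (cases n) auto
            finally show ?thesis by (simp add: eq_neg_iff_add_eq_0)
          qed
          also have "- ((-1) ^ n) * - ((-1) ^ n * X n j) = X n j"
            by (simp add: mult.assoc[symmetric] power_mult_distrib[symmetric])
          finally show ?thesis using True by simp
        next
          case F: False
          have "\<not> (i \<in> {1..n} \<and> j \<in> {1..k})" using F False by auto
          then have "X i j = 0"
            using X unfolding alternating_sum_mats_def mat_space_def by blast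
          moreover have "u p i j = 0" if "p \<in> ?I" for p
            using that F False assms by (auto simp: u_def unit_mat_def mscale_def)
          ultimately show ?thesis by (simp add: sum_apply2 mscale_def)
        qed
      qed
      then have "X = ?Y" by blast
      also have "\<dots> \<in> mat.span (u ` ?I)"
        by (intro mat.span_sum mat.span_scale mat.span_base) blast
      finally show "X \<in> mat.span (u ` ?I)" .
    qed
  qed
qed

lemma direction_translate:
  assumes "mat.subspace V"
  shows "direction ((\<lambda>v. s + v) ` V) = V"
proof
  show "direction ((\<lambda>v. s + v) ` V) \<subseteq> V"
    using mat.subspace_diff[OF assms] by (auto simp: direction_def)
  show "V \<subseteq> direction ((\<lambda>v. s + v) ` V)"
  proof
    fix v assume "v \<in> V"
    moreover have "v = (s + v) - (s + 0)" by simp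
    ultimately show "v \<in> direction ((\<lambda>v. s + v) ` V)"
      unfolding direction_def using mat.subspace_0[OF assms] by blast
  qed
qed

lemma subspace_alternating_sum_mats:
  "mat.subspace (alternating_sum_mats n k :: (nat \<Rightarrow> nat \<Rightarrow> 'a::field) set)"
proof -
  have "(\<Sum>i=1..n. (-1) ^ i * mscale c X i j) = c * (\<Sum>i=1..n. (-1) ^ i * X i j)"
    for c :: 'a and X :: "nat \<Rightarrow> nat \<Rightarrow> 'a" and j
    by (simp add: mscale_def sum_distrib_left mult_ac)
  then show ?thesis
    unfolding mat.subspace_def alternating_sum_mats_def
    by (auto simp: mat_space_0 mat_space_add mat_space_scale ring_distribs sum.distrib)
qed

theorem mainTheorem1:
  fixes K :: "(nat \<Rightarrow> nat \<Rightarrow> 'a::field) set" and n k :: nat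
  assumes "0 < k" and "k + 2 \<le> n" and "linear_variety n k K"
  shows "((\<forall>X\<in>K. cullis_det n k X = 0) \<and> variety_codim n k K = k) \<longleftrightarrow>
         (odd k \<and> K = {X \<in> mat_space n k. \<forall>j\<in>{1..k}. (\<Sum>i=1..n. (-1) ^ i * X i j) = 0})"
  unfolding alternating_sum_mats_def[symmetric]
proof
  assume *: "(\<forall>X\<in>K. cullis_det n k X = 0) \<and> variety_codim n k K = k"
  obtain s V where sV: "s \<in> mat_space n k" "mat.subspace V" "V \<subseteq> mat_space n k" "K = (\<lambda>v. s + v) ` V"
    using assms(3) unfolding linear_variety_def by blast
  have "n * k - mat.dim V \<le> k"
    using * direction_translate[OF sV(2), of s] by (simp add: variety_codim_def sV(4))
  then show "odd k \<and> K = alternating_sum_mats n k"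
    using variety_eq_alternating_sum_mats[OF assms(2) sV] * by blast
next
  assume *: "odd k \<and> K = alternating_sum_mats n k"
  have "cullis_det n k X = 0" if "X \<in> K" for X
    unfolding cullis_det_eq_0_iff
    by (rule maximal_minor_sum_odd) (use * that in \<open>auto simp: alternating_sum_mats_def\<close>)
  \<comment> \<open>The space is its own translate by 0.\<close>
  moreover have "direction K = K"
    using * direction_translate[OF subspace_alternating_sum_mats, of 0 n k] by simp
  then have "variety_codim n k K = n * k - (n - 1) * k"
    using * assms by (simp add: variety_codim_def dim_alternating_sum_mats)
  then have "variety_codim n k K = k"
    using assms by (simp flip: diff_mult_distrib)
  ultimately show "(\<forall>X\<in>K. cullis_det n k X = 0) \<and> variety_codim n k K = k" by blast
qed

end
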